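(* Let $W:\mathbb{R}^d\to(-\infty,\infty]$ be locally integrable, bounded below, lower semicontinuous and symmetric ($W(x)=W(-x)$). If $W$ is linear-interpolation-concave with size $\delta>0$, then for any $d_\infty$-local minimizer $\rho$ of the interaction energy $E$ associated to $W$ and any $\epsilon_0>0$, the set $\{x:\rho(x)\ge\epsilon_0\}$ does not contain a ball of radius $\delta$. In particular, if $W$ is infinitesimal-concave, then for any $d_\infty$-local minimizer $\rho$ and any $\epsilon_0>0$, the set $\{x:\rho(x)\ge\epsilon_0\}$ has no interior point.
   Context: $E[\mu]=\frac12\int\int W(x-y)\,d\mu(y)\,d\mu(x)$, for probability measures or (signed) functions $\mu$. $W$ is linear-interpolation-concave with size $\delta$ if there is a nonzero $\mu\in L^\infty(\mathbb{R}^d)$ with $\int\mu\,dx=0$ and $\operatorname{diam}(\operatorname{supp}\mu)\le\delta$ such that $E[\mu]<0$. $W$ is infinitesimal-concave if it is linear-interpolation-concave with size $\delta$ for every $\delta>0$. $d_\infty(\mu,\nu)=\inf_{\pi\in\Pi(\mu,\nu)}\sup_{(x,y)\in\operatorname{supp}\pi}|x-y|$ for compactly supported probability measures $\mu,\nu$ ($\Pi(\mu,\nu)$: transport plans). A (compactly supported) probability measure $\rho$ is a $d_\infty$-local minimizer of $E$ if there is $\epsilon>0$ with $E[\rho]\le E[\nu]$ for all compactly supported probability measures $\nu$ with $d_\infty(\rho,\nu)<\epsilon$. Meaning of $\{\rho\ge\epsilon_0\}$: write $\rho=\rho_c+\rho_s$ with $\rho_c\in L^1$ the absolutely continuous part and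 $\rho_s$ the part singular with respect to Lebesgue measure; then $\{x:\rho(x)\ge\epsilon_0\}$ means $\{x:\rho_c(x)\ge\epsilon_0\}$, and the conclusion is asserted for every representative of $\rho_c\in L^1$. *)

theory Defs
  imports "HOL-Analysis.Analysis" "HOL-Probability.Probability_Measure"
begin

text \<open>Functions with values in \<open>(-\<infinity>, \<infinity>]\<close> are rendered as \<^typ>\<open>ereal\<close>-valued functions.\<close>

definition lower_semicontinuous :: "('a::topological_space \<Rightarrow> ereal) \<Rightarrow> bool" where
  "lower_semicontinuous f \<longleftrightarrow> (\<forall>x. f x \<le> Liminf (at x) f)"

definition locally_integrable :: "('a::euclidean_space \<Rightarrow> ereal) \<Rightarrow> bool" where
  "locally_integrable f \<longleftrightarrow>
     f \<in> borel_measurable lebesgue \<and>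
     (\<forall>K. compact K \<longrightarrow> (\<integral>\<^sup>+x. e2ennreal \<bar>f x\<bar> * indicator K x \<partial>lebesgue) < \<infinity>)"

text \<open>Integral of an extended-real function, positive part minus negative part. It is the usual
  integral whenever one of the two is finite; this holds in the energies below for
  probability measures when \<open>W\<close> is bounded below, and for bounded functions with bounded
  support when \<open>W\<close> is locally integrable.\<close>

definition ereal_integral :: "'a measure \<Rightarrow> ('a \<Rightarrow> ereal) \<Rightarrow> ereal" where
  "ereal_integral M f =
     enn2ereal (\<integral>\<^sup>+x. e2ennreal (f x) \<partial>M) - enn2ereal (\<integral>\<^sup>+x. e2ennreal (- f x) \<partial>M)"

definition energy :: "('a::euclidean_space \<Rightarrow> ereal) \<Rightarrow> 'a measure \<Rightarrow> ereal" where
  "energy W \<mu> = ereal (1/2) * ereal_integral \<mu> (\<lambda>x. ereal_integral \<mu> (\<lambda>y. W (x - y)))"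

text \<open>The energy of the signed measure \<open>f dx\<close>.\<close>

definition energy_fun :: "('a::euclidean_space \<Rightarrow> ereal) \<Rightarrow> ('a \<Rightarrow> real) \<Rightarrow> ereal" where
  "energy_fun W f =
     ereal (1/2) * ereal_integral lebesgue
       (\<lambda>x. ereal_integral lebesgue (\<lambda>y. W (x - y) * ereal (f y)) * ereal (f x))"

definition ess_support :: "('a::euclidean_space \<Rightarrow> real) \<Rightarrow> 'a set" where
  "ess_support f = - \<Union>{U. open U \<and> (AE x in lebesgue. x \<in> U \<longrightarrow> f x = 0)}"

text \<open>Boundedness of the support is stated separately since \<^const>\<open>diameter\<close> is only
  meaningful on bounded sets.\<close>

definition linear_interpolation_concave :: "('a::euclidean_space \<Rightarrow> ereal) \<Rightarrow> real \<Rightarrow> bool" where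
  "linear_interpolation_concave W \<delta> \<longleftrightarrow>
     (\<exists>f. f \<in> borel_measurable lebesgue \<and>
          (\<exists>C. AE x in lebesgue. \<bar>f x\<bar> \<le> C) \<and>
          \<not> (AE x in lebesgue. f x = 0) \<and>
          bounded (ess_support f) \<and> diameter (ess_support f) \<le> \<delta> \<and>
          (\<integral>x. f x \<partial>lebesgue) = 0 \<and>
          energy_fun W f < 0)"

definition infinitesimal_concave :: "('a::euclidean_space \<Rightarrow> ereal) \<Rightarrow> bool" where
  "infinitesimal_concave W \<longleftrightarrow> (\<forall>\<delta>>0. linear_interpolation_concave W \<delta>)"

definition measure_support :: "'a::topological_space measure \<Rightarrow> 'a set" where
  "measure_support \<mu> = - \<Union>{U. open U \<and> emeasure \<mu> U = 0}"

definition compact_prob :: "'a::euclidean_space measure \<Rightarrow> bool" where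
  "compact_prob \<mu> \<longleftrightarrow> sets \<mu> = sets borel \<and> prob_space \<mu> \<and> compact (measure_support \<mu>)"

definition transport_plans ::
    "'a::euclidean_space measure \<Rightarrow> 'a measure \<Rightarrow> ('a \<times> 'a) measure set" where
  "transport_plans \<mu> \<nu> =
     {\<pi>. sets \<pi> = sets borel \<and> distr \<pi> borel fst = \<mu> \<and> distr \<pi> borel snd = \<nu>}"

definition d_infinity :: "'a::euclidean_space measure \<Rightarrow> 'a measure \<Rightarrow> ereal" where
  "d_infinity \<mu> \<nu> =
     (INF \<pi>\<in>transport_plans \<mu> \<nu>. SUP (x, y)\<in>measure_support \<pi>. ereal (norm (x - y)))"

definition d_infinity_local_minimizer ::
    "('a::euclidean_space \<Rightarrow> ereal) \<Rightarrow> 'a measure \<Rightarrow> bool" where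
  "d_infinity_local_minimizer W \<rho> \<longleftrightarrow>
     compact_prob \<rho> \<and>
     (\<exists>\<epsilon>>0. \<forall>\<nu>. compact_prob \<nu> \<and> d_infinity \<rho> \<nu> < ereal \<epsilon> \<longrightarrow> energy W \<rho> \<le> energy W \<nu>)"

text \<open>\<open>g\<close> is a representative of the density of the absolutely continuous part of \<open>\<rho>\<close> in
  its Lebesgue decomposition, with singular part \<open>\<sigma>\<close> concentrated on the null set \<open>N\<close>.
  As a representative of a class in \<open>L\<^sup>1\<close>, \<open>g\<close> need only be Lebesgue measurable and
  may take negative values on a null set.\<close>

definition is_ac_density :: "'a::euclidean_space measure \<Rightarrow> ('a \<Rightarrow> real) \<Rightarrow> bool" where
  "is_ac_density \<rho> g \<longleftrightarrow>
     integrable lebesgue g \<and> (AE x in lebesgue. 0 \<le> g x) \<and>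
     (\<exists>\<sigma> N. sets \<sigma> = sets borel \<and> N \<in> sets borel \<and>
        emeasure lborel N = 0 \<and> emeasure \<sigma> (- N) = 0 \<and>
        (\<forall>A\<in>sets borel.
           emeasure \<rho> A = (\<integral>\<^sup>+x. ennreal (g x) * indicator A x \<partial>lebesgue) + emeasure \<sigma> A))"

end

theory Submission
  imports Defs
begin

text \<open>
  Suppose that the density of \<open>\<rho>\<close> is at least \<open>\<epsilon>\<^sub>0\<close> on a ball \<open>B\<close> of radius \<open>\<delta>\<close>. A profile \<open>f\<close> of
  mean zero with \<open>E[f] < 0\<close> and essential support of diameter at most \<open>\<delta>\<close> can be translated so
  that it vanishes off \<open>B\<close> (\<open>concave_profile_on_ball\<close>). For small \<open>t > 0\<close> both \<open>\<rho> + t f\<close> and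
  \<open>\<rho> - t f\<close> are probability measures, \<open>\<rho>\<close> is their midpoint, and since \<open>E\<close> is a quadratic form,
  \<open>E[\<rho> + t f] + E[\<rho> - t f] = 2 E[\<rho>] + 2 t\<^sup>2 E[f] < 2 E[\<rho>]\<close>. One of the two competitors therefore has
  smaller energy than \<open>\<rho>\<close> (\<open>energy_decreases_along_perturbation\<close>). This contradicts local minimality once two points are settled.

  The competitors must be close to \<open>\<rho>\<close> in \<open>d\<^sub>\<infinity>\<close>, however small the radius of minimality is
  compared with \<open>\<delta>\<close>. Although \<open>t f\<close> transfers mass across the whole ball, the mass of \<open>\<rho>\<close>
  present everywhere in the ball can act as a relay. Couple \<open>t f\<^sup>-\<close> with \<open>t f\<^sup>+\<close>, subdivide each segment
  from source to target into \<open>n\<close> equal steps, and let the mass occupying the \<open>k\<close>-th points move to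
  the \<open>(k+1)\<close>-st. No mass travels further than \<open>2 \<delta> / n\<close>. The mass occupying the \<open>k\<close>-th
  points has density at most \<open>2\<^sup>d\<close> times the bound on \<open>t f\<close>, so for small \<open>t\<close> all these masses
  together are available in \<open>\<rho>\<close> (\<open>d_infinity_le_by_chain\<close>).

  The quadratic expansion needs \<open>E[\<rho>] < \<infinity>\<close>. A local minimizer satisfies this because spreading
  \<open>\<rho>\<close> uniformly over small balls gives a nearby measure with bounded density and compact support,
  whose energy is finite as \<open>W\<close> is locally integrable (\<open>mollified_measure_exists\<close>).

  To treat \<open>\<rho>\<close>, which may have a singular part, and \<open>f\<close> on the same footing, \<open>f dx\<close> is written as
  \<open>u \<rho>\<close> with \<open>u\<close> bounded and vanishing on the null set carrying the singular part. All energies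
  then become integrals of \<open>W (x - y)\<close> against bounded weights over the single measure
  \<open>\<rho> \<Otimes> \<rho>\<close>.
\<close>

section \<open>Extended-real integrals as Bochner integrals\<close>

lemma lower_semicontinuous_imp_borel:
  fixes f :: "'a::topological_space \<Rightarrow> ereal"
  assumes "lower_semicontinuous f"
  shows "f \<in> borel_measurable borel"
proof -
  have "open (f -` {a<..})" for a
  proof (subst open_subopen, safe)
    fix x assume "a < f x"
    also have "f x \<le> Liminf (at x) f"
      using assms by (simp add: lower_semicontinuous_def)
    finally have "eventually (\<lambda>y. a < f y) (at x)"
      by (rule less_LiminfD)
    then obtain S where "open S" "x \<in> S" "\<And>y. y \<in> S \<Longrightarrow> y \<noteq> x \<Longrightarrow> a < f y"
      by (auto simp: eventually_at_topological)
    with \<open>a < f x\<close> show "\<exists>T. open T \<and> x \<in> T \<and> T \<subseteq> f -` {a<..}"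
      by (intro exI[of _ S]) auto
  qed
  then show ?thesis
    by (simp add: borel_measurable_ereal_iff_Ioi)
qed

text \<open>
  For absolutely integrable kernels the extended-real integral is a Bochner integral, so that
  linearity becomes available: infinite values occur only on a null set.
\<close>
lemma
  assumes [measurable]: "k \<in> borel_measurable M"
    and fin: "(\<integral>\<^sup>+x. e2ennreal \<bar>k x\<bar> \<partial>M) < \<infinity>"
  shows integrable_real_of_ereal: "integrable M (\<lambda>x. real_of_ereal (k x))"
    and ereal_integral_eq_integral:
      "ereal_integral M k = ereal (\<integral>x. real_of_ereal (k x) \<partial>M)"
proof -
  let ?r = "\<lambda>x. real_of_ereal (k x)"
  have ae: "AE x in M. \<bar>k x\<bar> \<noteq> \<infinity>"
  proof -
    have "AE x in M. e2ennreal \<bar>k x\<bar> \<noteq> \<infinity>"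
      using fin by (intro nn_integral_PInf_AE) auto
    then show ?thesis
      by eventually_elim (auto simp: less_top)
  qed
  show int: "integrable M ?r"
  proof (rule integrableI_bounded)
    have "(\<integral>\<^sup>+x. ennreal (norm (?r x)) \<partial>M) \<le> (\<integral>\<^sup>+x. e2ennreal \<bar>k x\<bar> \<partial>M)"
    proof (rule nn_integral_mono)
      show "ennreal (norm (?r x)) \<le> e2ennreal \<bar>k x\<bar>" for x
        by (cases "k x") auto
    qed
    then show "(\<integral>\<^sup>+x. ennreal (norm (?r x)) \<partial>M) < \<infinity>"
      using fin by simp
  qed simp
  have "(\<integral>\<^sup>+x. e2ennreal (k x) \<partial>M) = (\<integral>\<^sup>+x. ennreal (?r x) \<partial>M)"
    using ae by (intro nn_integral_cong_AE) (auto simp: ereal_real)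
  moreover have "(\<integral>\<^sup>+x. e2ennreal (- k x) \<partial>M) = (\<integral>\<^sup>+x. ennreal (- ?r x) \<partial>M)"
  proof (intro nn_integral_cong_AE, use ae in eventually_elim)
    case (elim x)
    then show ?case by (cases "k x") auto
  qed
  moreover have "(\<integral>\<^sup>+x. ennreal (?r x) \<partial>M) \<noteq> \<infinity>" "(\<integral>\<^sup>+x. ennreal (- ?r x) \<partial>M) \<noteq> \<infinity>"
    using int by (auto simp: real_integrable_def)
  ultimately show "ereal_integral M k = ereal (\<integral>x. ?r x \<partial>M)"
    unfolding ereal_integral_def real_lebesgue_integral_def[OF int]
    by (cases "\<integral>\<^sup>+x. ennreal (?r x) \<partial>M"; cases "\<integral>\<^sup>+x. ennreal (- ?r x) \<partial>M") auto
qed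

lemma ereal_integral_cong_AE:
  assumes "AE x in M. h x = k x"
  shows "ereal_integral M h = ereal_integral M k"
  using assms unfolding ereal_integral_def
  by (intro arg_cong2[where f="(-)"] arg_cong[where f=enn2ereal] nn_integral_cong_AE) auto

text \<open>
  Fubini: for almost every \<open>x\<close> the inner integral is finite, and changing it on the remaining
  null set does not affect the outer one.
\<close>
lemma iterated_ereal_integral_eq_integral:
  fixes k :: "'a \<Rightarrow> 'a \<Rightarrow> ereal"
  assumes "sigma_finite_measure M"
    and [measurable]: "case_prod k \<in> borel_measurable (M \<Otimes>\<^sub>M M)"
    and fin: "(\<integral>\<^sup>+z. e2ennreal \<bar>case_prod k z\<bar> \<partial>(M \<Otimes>\<^sub>M M)) < \<infinity>"
  shows "ereal_integral M (\<lambda>x. ereal_integral M (k x)) =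
           ereal (\<integral>z. real_of_ereal (case_prod k z) \<partial>(M \<Otimes>\<^sub>M M))"
proof -
  interpret M: sigma_finite_measure M by fact
  interpret pair_sigma_finite M M ..
  let ?r = "\<lambda>x y. real_of_ereal (k x y)"
  have int: "integrable (M \<Otimes>\<^sub>M M) (case_prod ?r)"
    using integrable_real_of_ereal[OF _ fin] by (simp add: split_beta')
  have "(\<integral>\<^sup>+x. \<integral>\<^sup>+y. e2ennreal \<bar>k x y\<bar> \<partial>M \<partial>M) < \<infinity>"
    using fin M.nn_integral_fst[where f="\<lambda>z. e2ennreal \<bar>case_prod k z\<bar>" and ?M1.0=M] by simp
  then have "AE x in M. (\<integral>\<^sup>+y. e2ennreal \<bar>k x y\<bar> \<partial>M) \<noteq> \<infinity>"
    by (intro nn_integral_PInf_AE) auto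
  then have "AE x in M. ereal_integral M (k x) = ereal (\<integral>y. ?r x y \<partial>M)"
  proof (rule AE_mp, intro AE_I2 impI)
    fix x assume x: "x \<in> space M" and "(\<integral>\<^sup>+y. e2ennreal \<bar>k x y\<bar> \<partial>M) \<noteq> \<infinity>"
    then show "ereal_integral M (k x) = ereal (\<integral>y. ?r x y \<partial>M)"
      by (intro ereal_integral_eq_integral) (auto simp: less_top)
  qed
  then have "ereal_integral M (\<lambda>x. ereal_integral M (k x)) = ereal_integral M (\<lambda>x. ereal (\<integral>y. ?r x y \<partial>M))"
    by (rule ereal_integral_cong_AE)
  also have "\<dots> = ereal (\<integral>x. real_of_ereal (ereal (\<integral>y. ?r x y \<partial>M)) \<partial>M)"
  proof (rule ereal_integral_eq_integral)
    show "(\<lambda>x. ereal (\<integral>y. ?r x y \<partial>M)) \<in> borel_measurable M"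
      by measurable
    have "(\<integral>\<^sup>+x. ennreal (norm (\<integral>y. ?r x y \<partial>M)) \<partial>M) < \<infinity>"
      using integrable_fst[OF int] by (simp add: integrable_iff_bounded)
    then show "(\<integral>\<^sup>+x. e2ennreal \<bar>ereal (\<integral>y. ?r x y \<partial>M)\<bar> \<partial>M) < \<infinity>"
      by simp
  qed
  also have "\<dots> = ereal (\<integral>z. real_of_ereal (case_prod k z) \<partial>(M \<Otimes>\<^sub>M M))"
    using integral_fst[OF int] by (simp add: split_beta')
  finally show ?thesis .
qed

section \<open>Energies as double integrals\<close>

text \<open>
  Because \<open>W\<close> is bounded below and \<open>\<mu>\<close> is a probability measure, the negative part of \<open>W\<close> contributes only a
  finite amount. Hence the positive part must be integrable as soon as the energy is
  not \<open>\<infinity>\<close>.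
\<close>
lemma finite_energy_imp_finite_interaction:
  fixes W :: "'a::euclidean_space \<Rightarrow> ereal"
  assumes mu: "sets \<mu> = sets borel" "prob_space \<mu>"
    and [measurable]: "W \<in> borel_measurable borel"
    and c: "\<And>x. ereal c \<le> W x"
    and fin: "energy W \<mu> < \<infinity>"
  shows "(\<integral>\<^sup>+z. e2ennreal \<bar>W (fst z - snd z)\<bar> \<partial>(\<mu> \<Otimes>\<^sub>M \<mu>)) < \<infinity>"
proof -
  note [measurable_cong] = mu(1)
  interpret prob_space \<mu> by fact
  define p where "p x = (\<integral>\<^sup>+y. e2ennreal (W (x - y)) \<partial>\<mu>)" for x
  define n where "n x = (\<integral>\<^sup>+y. e2ennreal (- W (x - y)) \<partial>\<mu>)" for x
  have [measurable]: "p \<in> borel_measurable \<mu>" "n \<in> borel_measurable \<mu>"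
    unfolding p_def n_def by measurable
  let ?c = "ennreal \<bar>c\<bar>"
  have neg: "e2ennreal (- W x) \<le> ?c" for x
    using c[of x] by (cases "W x") (auto intro!: ennreal_leI simp: e2ennreal_neg)
  have n_le: "n x \<le> ?c" for x
  proof -
    have "n x \<le> (\<integral>\<^sup>+y. ?c \<partial>\<mu>)"
      unfolding n_def by (intro nn_integral_mono neg)
    then show ?thesis by (simp add: emeasure_space_1)
  qed
  have inner: "ereal_integral \<mu> (\<lambda>y. W (x - y)) = enn2ereal (p x) - enn2ereal (n x)" for x
    by (simp add: ereal_integral_def p_def n_def)
  have eq: "ereal_integral \<mu> (\<lambda>x. ereal_integral \<mu> (\<lambda>y. W (x - y))) =
      enn2ereal (\<integral>\<^sup>+x. p x - n x \<partial>\<mu>) - enn2ereal (\<integral>\<^sup>+x. n x - p x \<partial>\<mu>)"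
  proof -
    have "e2ennreal (- (enn2ereal (p x) - enn2ereal (n x))) = n x - p x" for x
      using e2eenreal_enn2ereal_diff[of "n x" "p x"] n_le[of x]
      by (subst ereal_minus_diff_eq) (auto simp: top_unique)
    then show ?thesis
      unfolding inner by (subst ereal_integral_def) simp
  qed
  have "(\<integral>\<^sup>+x. n x - p x \<partial>\<mu>) \<le> (\<integral>\<^sup>+x. ?c \<partial>\<mu>)"
  proof (intro nn_integral_mono)
    show "n x - p x \<le> ?c" for x
      using n_le[of x] diff_le_self_ennreal[of "n x" "p x"] by (rule order_trans[rotated])
  qed
  also have "\<dots> < \<infinity>" by (simp add: emeasure_space_1)
  finally have "(\<integral>\<^sup>+x. n x - p x \<partial>\<mu>) < \<infinity>" .
  with fin have pn: "(\<integral>\<^sup>+x. p x - n x \<partial>\<mu>) < \<infinity>"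
    unfolding energy_def eq
    by (cases "\<integral>\<^sup>+x. p x - n x \<partial>\<mu>"; cases "\<integral>\<^sup>+x. n x - p x \<partial>\<mu>") auto
  have "(\<integral>\<^sup>+z. e2ennreal \<bar>W (fst z - snd z)\<bar> \<partial>(\<mu> \<Otimes>\<^sub>M \<mu>)) = (\<integral>\<^sup>+x. \<integral>\<^sup>+y. e2ennreal \<bar>W (x - y)\<bar> \<partial>\<mu> \<partial>\<mu>)"
    by (subst nn_integral_fst[symmetric]) auto
  also have "\<dots> \<le> (\<integral>\<^sup>+x. (p x - n x) + (?c + ?c) \<partial>\<mu>)"
  proof (intro nn_integral_mono)
    fix x
    have "(\<integral>\<^sup>+y. e2ennreal \<bar>W (x - y)\<bar> \<partial>\<mu>) \<le> (\<integral>\<^sup>+y. e2ennreal (W (x - y)) + ?c \<partial>\<mu>)"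
    proof (intro nn_integral_mono)
      show "e2ennreal \<bar>W (x - y)\<bar> \<le> e2ennreal (W (x - y)) + ?c" for y
        using neg[of "x - y"] c[of "x - y"] by (cases "W (x - y)") (auto simp: abs_real_def ennreal_neg split: if_splits)
    qed
    also have "\<dots> = p x + ?c"
      unfolding p_def by (subst nn_integral_add) (auto simp: emeasure_space_1)
    also have "p x \<le> (p x - n x) + n x"
      by (cases "n x \<le> p x") (auto simp: diff_add_self_ennreal diff_eq_0_ennreal)
    also have "\<dots> \<le> (p x - n x) + ?c"
      by (intro add_left_mono n_le)
    finally show "(\<integral>\<^sup>+y. e2ennreal \<bar>W (x - y)\<bar> \<partial>\<mu>) \<le> (p x - n x) + (?c + ?c)"
      by (simp add: add_ac)
  qed
  also have "\<dots> = (\<integral>\<^sup>+x. p x - n x \<partial>\<mu>) + (?c + ?c)"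
    by (subst nn_integral_add) (auto simp: emeasure_space_1)
  also have "\<dots> < \<infinity>"
    using pn by (auto simp: less_top)
  finally show ?thesis .
qed

lemma energy_eq_integral:
  fixes W :: "'a::euclidean_space \<Rightarrow> ereal"
  assumes mu: "sets \<mu> = sets borel" "sigma_finite_measure \<mu>"
    and [measurable]: "W \<in> borel_measurable borel"
    and fin: "(\<integral>\<^sup>+z. e2ennreal \<bar>W (fst z - snd z)\<bar> \<partial>(\<mu> \<Otimes>\<^sub>M \<mu>)) < \<infinity>"
  shows "energy W \<mu> = ereal (1/2 * (\<integral>z. real_of_ereal (W (fst z - snd z)) \<partial>(\<mu> \<Otimes>\<^sub>M \<mu>)))"
proof -
  note [measurable_cong] = mu(1)
  show ?thesis
    unfolding energy_def
    using iterated_ereal_integral_eq_integral[OF mu(2), of "\<lambda>x y. W (x - y)"] fin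
    by (simp add: split_beta')
qed

text \<open>
  The factor \<open>f x\<close> can be pulled inside the inner integral for almost every \<open>x\<close>: either it is
  zero, or the inner integral is absolutely convergent.
\<close>
lemma energy_fun_eq_integral:
  fixes W :: "'a::euclidean_space \<Rightarrow> ereal"
  assumes [measurable]: "W \<in> borel_measurable borel" "f \<in> borel_measurable borel"
    and fin: "(\<integral>\<^sup>+z. e2ennreal \<bar>W (fst z - snd z) * ereal (f (snd z)) * ereal (f (fst z))\<bar>
                 \<partial>(lborel \<Otimes>\<^sub>M lborel)) < \<infinity>"
  shows "energy_fun W f = ereal (1/2 * (\<integral>z. real_of_ereal (W (fst z - snd z)) * f (fst z) * f (snd z)
                 \<partial>(lborel \<Otimes>\<^sub>M lborel)))"
proof -
  interpret pair_sigma_finite lborel lborel ..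
  let ?k = "\<lambda>x y. W (x - y) * ereal (f y)"
  have completion: "ereal_integral lebesgue h = ereal_integral lborel h" for h :: "'a \<Rightarrow> ereal"
    by (simp add: ereal_integral_def nn_integral_completion)
  have "(\<integral>\<^sup>+x. \<integral>\<^sup>+y. e2ennreal \<bar>?k x y * ereal (f x)\<bar> \<partial>lborel \<partial>lborel) < \<infinity>"
    using fin by (subst (asm) lborel.nn_integral_fst[symmetric]) auto
  then have "AE x in lborel. (\<integral>\<^sup>+y. e2ennreal \<bar>?k x y * ereal (f x)\<bar> \<partial>lborel) \<noteq> \<infinity>"
    by (intro nn_integral_PInf_AE) auto
  then have "AE x in lborel. ereal_integral lborel (?k x) * ereal (f x) =
      ereal_integral lborel (\<lambda>y. ?k x y * ereal (f x))"
  proof eventually_elim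
    case (elim x)
    show ?case
    proof (cases "f x = 0")
      case True
      then show ?thesis by (simp add: ereal_integral_def zero_ereal_def[symmetric] e2ennreal_neg)
    next
      case False
      have "ereal_integral lborel (\<lambda>y. ?k x y * ereal (f x)) =
          ereal (\<integral>y. real_of_ereal (?k x y * ereal (f x)) \<partial>lborel)"
        using elim by (intro ereal_integral_eq_integral) (auto simp: less_top)
      moreover have "ereal_integral lborel (?k x) = ereal (\<integral>y. real_of_ereal (?k x y) \<partial>lborel)"
      proof (rule ereal_integral_eq_integral)
        have "(\<integral>\<^sup>+y. e2ennreal \<bar>?k x y\<bar> \<partial>lborel) =
              (\<integral>\<^sup>+y. ennreal (1 / \<bar>f x\<bar>) * e2ennreal \<bar>?k x y * ereal (f x)\<bar> \<partial>lborel)"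
        proof (intro nn_integral_cong)
          fix y
          show "e2ennreal \<bar>?k x y\<bar> = ennreal (1 / \<bar>f x\<bar>) * e2ennreal \<bar>?k x y * ereal (f x)\<bar>"
            using False
            by (cases "?k x y") (auto simp: ennreal_mult[symmetric] abs_mult ennreal_mult_top)
        qed
        also have "\<dots> = ennreal (1 / \<bar>f x\<bar>) * (\<integral>\<^sup>+y. e2ennreal \<bar>?k x y * ereal (f x)\<bar> \<partial>lborel)"
          by (intro nn_integral_cmult) auto
        also have "\<dots> < \<infinity>"
          using elim by (auto simp: ennreal_mult_less_top less_top)
        finally show "(\<integral>\<^sup>+y. e2ennreal \<bar>?k x y\<bar> \<partial>lborel) < \<infinity>" .
      qed simp
      ultimately show ?thesis by simp
    qed
  qed
  then have "energy_fun W f = ereal (1/2) * ereal_integral lborel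
      (\<lambda>x. ereal_integral lborel (\<lambda>y. ?k x y * ereal (f x)))"
    unfolding energy_fun_def completion by (intro arg_cong2[where f="(*)"] ereal_integral_cong_AE refl)
  also have "\<dots> = ereal (1/2) * ereal (\<integral>z. real_of_ereal (W (fst z - snd z) * ereal (f (snd z)) * ereal (f (fst z)))
                 \<partial>(lborel \<Otimes>\<^sub>M lborel))"
    using iterated_ereal_integral_eq_integral[OF sigma_finite_lborel, of "\<lambda>x y. ?k x y * ereal (f x)"] fin
    by (simp add: split_beta')
  finally show ?thesis
    by (simp add: ac_simps)
qed

section \<open>Finite energy of local minimizers\<close>

lemma closed_measure_support: "closed (measure_support \<mu>)"
  unfolding measure_support_def by (intro closed_Compl open_Union) auto

lemma measure_support_subset:
  assumes "closed C" "emeasure \<mu> (- C) = 0"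
  shows "measure_support \<mu> \<subseteq> C"
  using assms unfolding measure_support_def by (blast intro: open_Compl)

text \<open>
  The complement of the support is a union of null open sets, and by the Lindelof property
  countably many of them suffice.
\<close>
lemma AE_in_measure_support:
  fixes \<mu> :: "'a::euclidean_space measure"
  assumes "sets \<mu> = sets borel"
  shows "AE x in \<mu>. x \<in> measure_support \<mu>"
proof -
  let ?F = "{U. open U \<and> emeasure \<mu> U = 0}"
  obtain F where F: "F \<subseteq> ?F" "countable F" "\<Union>F = \<Union>?F"
    by (rule Lindelof[of ?F]) auto
  have "(\<Union>U\<in>F. U) \<in> null_sets \<mu>"
  proof (rule null_sets_UN'[OF F(2)])
    show "U \<in> null_sets \<mu>" if "U \<in> F" for U
      using that F(1) assms by (auto intro!: null_setsI)
  qed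
  then have "\<Union>F \<in> null_sets \<mu>"
    by simp
  then show ?thesis
    unfolding measure_support_def F(3)[symmetric] by (rule AE_I') auto
qed

lemma compact_probI:
  fixes \<mu> :: "'a::euclidean_space measure"
  assumes "sets \<mu> = sets borel" "prob_space \<mu>" "compact C" "emeasure \<mu> (- C) = 0"
  shows "compact_prob \<mu>"
proof -
  have "compact (C \<inter> measure_support \<mu>)"
    using assms by (intro compact_Int_closed closed_measure_support)
  moreover have "measure_support \<mu> \<subseteq> C"
    using assms by (intro measure_support_subset compact_imp_closed)
  ultimately show ?thesis
    using assms by (simp add: compact_prob_def inf.absorb2)
qed

lemma nn_integral_lborel_reflect:
  fixes h :: "'a::euclidean_space \<Rightarrow> ennreal"
  assumes [measurable]: "h \<in> borel_measurable borel"
  shows "(\<integral>\<^sup>+u. h (t - u) \<partial>lborel) = (\<integral>\<^sup>+u. h u \<partial>lborel)"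
proof -
  have eq: "distr lborel borel (\<lambda>u. t - u) = lborel"
    using lborel_affine[of "-1" t] by (simp add: density_1)
  have "(\<integral>\<^sup>+u. h (t - u) \<partial>lborel) = (\<integral>\<^sup>+u. h u \<partial>distr lborel borel (\<lambda>u. t - u))"
    by (rule nn_integral_distr[symmetric]) auto
  then show ?thesis
    unfolding eq .
qed

text \<open>
  The law of \<open>X + U\<close>, with \<open>X\<close> distributed as \<open>\<rho>\<close> and \<open>U\<close> independent and uniform in the ball of
  radius \<open>r\<close>. The joint law of \<open>X\<close> and \<open>X + U\<close> is a plan of displacement at most \<open>r\<close>. Averaging
  \<open>\<bar>W\<bar>\<close> over \<open>U\<close> alone is bounded uniformly on bounded sets, by local integrability.
\<close>
lemma mollified_measure_exists:
  fixes W :: "'a::euclidean_space \<Rightarrow> ereal"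
  assumes [measurable]: "W \<in> borel_measurable borel" and loc: "locally_integrable W"
    and \<rho>: "compact_prob \<rho>" and r: "r > 0"
  obtains \<nu> where "compact_prob \<nu>" "d_infinity \<rho> \<nu> \<le> ereal r"
    "(\<integral>\<^sup>+z. e2ennreal \<bar>W (fst z - snd z)\<bar> \<partial>(\<nu> \<Otimes>\<^sub>M \<nu>)) < \<infinity>"
proof -
  have sets_\<rho>[measurable_cong]: "sets \<rho> = sets borel" and "prob_space \<rho>" and "compact (measure_support \<rho>)"
    using \<rho> by (auto simp: compact_prob_def)
  interpret \<rho>: prob_space \<rho> by fact
  obtain K where K: "\<And>x. x \<in> measure_support \<rho> \<Longrightarrow> norm x \<le> K"
    using compact_imp_bounded[OF \<open>compact (measure_support \<rho>)\<close>] by (auto simp: bounded_iff)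
  have AE_\<rho>: "AE x in \<rho>. norm x \<le> K"
    using AE_in_measure_support[OF sets_\<rho>] by eventually_elim (rule K)
  define V where "V = emeasure lborel (cball (0::'a) r)"
  have "unit_ball_vol (real DIM('a)) \<noteq> 0"
    using unit_ball_vol_pos[of "real DIM('a)"] by (metis less_irrefl of_nat_0_le_iff)
  then have V: "V \<noteq> 0" "V \<noteq> \<infinity>"
    using r emeasure_lborel_cball_finite[of "0::'a" r] by (auto simp: V_def emeasure_cball)
  define U where "U = uniform_measure lborel (cball (0::'a) r)"
  have sets_U[measurable_cong]: "sets U = sets borel"
    by (simp add: U_def)
  interpret U: prob_space U
    unfolding U_def using V by (intro prob_space_uniform_measure) (auto simp: V_def)
  interpret P: pair_prob_space \<rho> U ..
  have AE_U: "AE u in U. norm u \<le> r"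
    unfolding U_def by (rule AE_uniform_measureI) auto
  define \<nu> where "\<nu> = distr (\<rho> \<Otimes>\<^sub>M U) borel (\<lambda>z. fst z + snd z)"
  have sets_\<nu>[measurable_cong]: "sets \<nu> = sets borel"
    by (simp add: \<nu>_def)
  interpret \<nu>: prob_space \<nu>
    unfolding \<nu>_def by (rule P.prob_space_distr) measurable
  have AE_pair: "AE z in \<rho> \<Otimes>\<^sub>M U. norm (fst z) \<le> K \<and> norm (snd z) \<le> r"
  proof (rule P.AE_pair_measure)
    show "AE x in \<rho>. AE y in U. norm (fst (x, y)) \<le> K \<and> norm (snd (x, y)) \<le> r"
      using AE_\<rho>
    proof eventually_elim
      case (elim x)
      show ?case using AE_U by eventually_elim (simp add: elim)
    qed
  qed measurable
  have AE_\<nu>: "AE x in \<nu>. norm x \<le> K + r"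
    unfolding \<nu>_def
  proof (subst AE_distr_iff)
    show "AE z in \<rho> \<Otimes>\<^sub>M U. norm (fst z + snd z) \<le> K + r"
      using AE_pair by eventually_elim (auto intro: norm_triangle_le)
  qed auto
  have "compact_prob \<nu>"
  proof (rule compact_probI)
    show "emeasure \<nu> (- cball 0 (K + r)) = 0"
      using AE_\<nu> by (subst (asm) AE_iff_measurable[OF _ refl]) (auto simp: sets_\<nu> Compl_eq space_borel sets_eq_imp_space_eq[OF sets_\<nu>])
  qed (fact sets_\<nu> \<nu>.prob_space_axioms compact_cball)+
  moreover have "d_infinity \<rho> \<nu> \<le> ereal r"
  proof -
    define \<pi> where "\<pi> = distr (\<rho> \<Otimes>\<^sub>M U) borel (\<lambda>z. (fst z, fst z + snd z))"
    have mm[measurable]: "(\<lambda>z. (fst z, fst z + snd z)) \<in> \<rho> \<Otimes>\<^sub>M U \<rightarrow>\<^sub>M borel"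
      unfolding borel_prod[symmetric] by measurable
    have [measurable]: "fst \<in> (borel :: ('a \<times> 'a) measure) \<rightarrow>\<^sub>M borel" "snd \<in> (borel :: ('a \<times> 'a) measure) \<rightarrow>\<^sub>M borel"
      unfolding borel_prod[symmetric] by measurable
    have "distr \<pi> borel fst = distr (\<rho> \<Otimes>\<^sub>M U) \<rho> fst"
      unfolding \<pi>_def by (subst distr_distr) (auto simp: comp_def intro!: distr_cong sets_\<rho>[symmetric])
    also have "\<dots> = \<rho>"
      by (rule U.distr_pair_fst)
    finally have "\<pi> \<in> transport_plans \<rho> \<nu>"
      unfolding transport_plans_def by (auto simp: \<pi>_def \<nu>_def distr_distr comp_def)
    moreover have "measure_support \<pi> \<subseteq> {z. norm (fst z - snd z) \<le> r}"
    proof (rule measure_support_subset)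
      show "closed {z :: 'a \<times> 'a. norm (fst z - snd z) \<le> r}"
        by (intro closed_Collect_le continuous_intros)
      then have *: "- {z :: 'a \<times> 'a. norm (fst z - snd z) \<le> r} \<in> sets borel"
        by auto
      have "AE z in \<pi>. z \<notin> - {z. norm (fst z - snd z) \<le> r}"
        unfolding \<pi>_def
      proof (subst AE_distr_iff)
        show "AE z in \<rho> \<Otimes>\<^sub>M U. (fst z, fst z + snd z) \<notin> - {z. norm (fst z - snd z) \<le> r}"
          using AE_pair by eventually_elim auto
      qed (use * in \<open>auto simp: Compl_eq\<close>)
      then show "emeasure \<pi> (- {z. norm (fst z - snd z) \<le> r}) = 0"
        using * by (subst (asm) AE_iff_measurable[OF _ refl]) (auto simp: \<pi>_def Compl_eq)
    qed
    ultimately show ?thesis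
      unfolding d_infinity_def by (intro INF_lower2[of \<pi>] SUP_least) auto
  qed
  moreover have "(\<integral>\<^sup>+z. e2ennreal \<bar>W (fst z - snd z)\<bar> \<partial>(\<nu> \<Otimes>\<^sub>M \<nu>)) < \<infinity>"
  proof -
    \<comment> \<open>Points of the support of \<open>\<nu>\<close> and \<open>\<rho>\<close> have norm at most \<open>K + r\<close> and \<open>K\<close>, and the average over \<open>U\<close> adds another \<open>r\<close>.\<close>
    let ?R = "2 * K + 2 * r"
    let ?w = "\<lambda>x. e2ennreal \<bar>W x\<bar>"
    define L where "L = (\<integral>\<^sup>+x. ?w x * indicator (cball 0 ?R) x \<partial>lborel)"
    have [measurable]: "cball (0::'a) s \<in> sets borel" for s
      by simp
    have "L < \<infinity>"
      using loc by (auto simp: locally_integrable_def L_def nn_integral_completion)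
    have inner: "(\<integral>\<^sup>+u. ?w (t - u) \<partial>U) \<le> L / V" if "norm t \<le> 2 * K + r" for t
    proof -
      have "(\<integral>\<^sup>+u. ?w (t - u) \<partial>U) = (\<integral>\<^sup>+u. ?w (t - u) * indicator (cball 0 r) u \<partial>lborel) / V"
        unfolding U_def V_def by (rule nn_integral_uniform_measure) auto
      also have "(\<integral>\<^sup>+u. ?w (t - u) * indicator (cball 0 r) u \<partial>lborel) \<le>
          (\<integral>\<^sup>+u. ?w (t - u) * indicator (cball 0 ?R) (t - u) \<partial>lborel)"
        using that by (intro nn_integral_mono mult_left_mono) (auto simp: indicator_def intro: norm_triangle_le_diff)
      also have "\<dots> = L"
        unfolding L_def by (rule nn_integral_lborel_reflect) measurable
      finally show ?thesis by (simp add: divide_right_mono_ennreal)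
    qed
    have "(\<integral>\<^sup>+z. ?w (fst z - snd z) \<partial>(\<nu> \<Otimes>\<^sub>M \<nu>)) = (\<integral>\<^sup>+x. \<integral>\<^sup>+y. ?w (x - y) \<partial>\<nu> \<partial>\<nu>)"
      by (subst \<nu>.nn_integral_fst[symmetric]) auto
    also have "\<dots> \<le> (\<integral>\<^sup>+x. L / V \<partial>\<nu>)"
    proof (rule nn_integral_mono_AE, use AE_\<nu> in eventually_elim)
      case (elim x)
      have "(\<integral>\<^sup>+y. ?w (x - y) \<partial>\<nu>) = (\<integral>\<^sup>+z. ?w (x - (fst z + snd z)) \<partial>(\<rho> \<Otimes>\<^sub>M U))"
        unfolding \<nu>_def by (subst nn_integral_distr) auto
      also have "\<dots> = (\<integral>\<^sup>+x'. \<integral>\<^sup>+u. ?w ((x - x') - u) \<partial>U \<partial>\<rho>)"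
        by (subst U.nn_integral_fst[symmetric]) (auto simp: algebra_simps)
      also have "\<dots> \<le> (\<integral>\<^sup>+x'. L / V \<partial>\<rho>)"
      proof (rule nn_integral_mono_AE, use AE_\<rho> in eventually_elim)
        case (elim x')
        show ?case
          using elim \<open>norm x \<le> K + r\<close> by (intro inner) (auto intro: norm_triangle_le_diff)
      qed
      also have "\<dots> = L / V" by (simp add: \<rho>.emeasure_space_1)
      finally show ?case .
    qed
    also have "\<dots> = L / V" by (simp add: \<nu>.emeasure_space_1)
    also have "\<dots> < \<infinity>"
      using \<open>L < \<infinity>\<close> V unfolding infinity_ennreal_def less_top[symmetric]
      by (simp add: ennreal_divide_eq_top_iff)
    finally show ?thesis .
  qed
  ultimately show thesis by (rule that)
qed

text \<open>
  The minimizer has at most the energy of its mollification at half the radius of minimality.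
\<close>
lemma local_minimizer_finite_interaction:
  fixes W :: "'a::euclidean_space \<Rightarrow> ereal"
  assumes [measurable]: "W \<in> borel_measurable borel" and loc: "locally_integrable W"
    and c: "\<And>x. ereal c \<le> W x"
    and min: "d_infinity_local_minimizer W \<rho>"
  shows "(\<integral>\<^sup>+z. e2ennreal \<bar>W (fst z - snd z)\<bar> \<partial>(\<rho> \<Otimes>\<^sub>M \<rho>)) < \<infinity>"
proof -
  obtain \<epsilon> where \<rho>: "compact_prob \<rho>" and "\<epsilon> > 0" and
    le: "\<And>\<nu>. compact_prob \<nu> \<Longrightarrow> d_infinity \<rho> \<nu> < ereal \<epsilon> \<Longrightarrow> energy W \<rho> \<le> energy W \<nu>"
    using min by (auto simp: d_infinity_local_minimizer_def)
  obtain \<nu> where \<nu>: "compact_prob \<nu>" "d_infinity \<rho> \<nu> \<le> ereal (\<epsilon> / 2)"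
    "(\<integral>\<^sup>+z. e2ennreal \<bar>W (fst z - snd z)\<bar> \<partial>(\<nu> \<Otimes>\<^sub>M \<nu>)) < \<infinity>"
    using mollified_measure_exists[OF assms(1) loc \<rho>, of "\<epsilon> / 2"] \<open>\<epsilon> > 0\<close> by auto
  have "d_infinity \<rho> \<nu> < ereal \<epsilon>"
    using \<nu>(2) \<open>\<epsilon> > 0\<close> by (auto elim!: order_le_less_trans)
  with \<nu>(1) have "energy W \<rho> \<le> energy W \<nu>" by (rule le)
  also have "\<dots> < \<infinity>"
    using \<nu> by (subst energy_eq_integral)
      (auto simp: compact_prob_def prob_space_imp_sigma_finite)
  finally show ?thesis
    using \<rho> c by (intro finite_energy_imp_finite_interaction) (auto simp: compact_prob_def)
qed

section \<open>Transport in short steps along segments\<close>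

lemma finite_sum_measure_exists:
  fixes M :: "'i \<Rightarrow> 'a::topological_space measure"
  assumes sets: "\<And>i. i \<in> I \<Longrightarrow> sets (M i) = sets borel"
  obtains S where "sets S = sets borel"
    "\<And>A. A \<in> sets borel \<Longrightarrow> emeasure S A = (\<Sum>i\<in>I. emeasure (M i) A)"
proof
  let ?\<mu> = "\<lambda>A. \<Sum>i\<in>I. emeasure (M i) A"
  let ?S = "measure_of UNIV (sets borel) ?\<mu>"
  have sa: "sigma_algebra UNIV (sets (borel :: 'a measure))"
    using sets.sigma_algebra_axioms[of "borel :: 'a measure"] by simp
  show "sets ?S = sets borel"
    using sigma_algebra.sets_measure_of_eq[OF sa] by simp
  show "emeasure ?S A = ?\<mu> A" if "A \<in> sets borel" for A
  proof (rule emeasure_measure_of_sigma[OF sa _ _ that])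
    show "positive (sets borel) ?\<mu>"
      by (simp add: positive_def)
    show "countably_additive (sets borel) ?\<mu>"
    proof (rule countably_additiveI)
      fix A :: "nat \<Rightarrow> 'a set"
      assume A: "range A \<subseteq> sets borel" "disjoint_family A"
      have "(\<Sum>n. ?\<mu> (A n)) = (\<Sum>i\<in>I. \<Sum>n. emeasure (M i) (A n))"
        by (rule suminf_sum) simp
      also have "\<dots> = ?\<mu> (\<Union>n. A n)"
        using A sets by (intro sum.cong refl suminf_emeasure) auto
      finally show "(\<Sum>n. ?\<mu> (A n)) = ?\<mu> (\<Union>n. A n)" .
    qed
  qed
qed

text \<open>
  The preimage has \<open>c\<^sup>-\<^sup>d\<close> times the volume of \<open>A\<close>, where \<open>d\<close> is the dimension.
\<close>
lemma emeasure_lborel_affine_vimage_le: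
  fixes t :: "'a::euclidean_space"
  assumes "1/2 \<le> c" and [measurable]: "A \<in> sets borel"
  shows "emeasure lborel ((\<lambda>x. t + c *\<^sub>R x) -` A) \<le> 2 ^ DIM('a) * emeasure lborel A"
proof -
  let ?V = "(\<lambda>x. t + c *\<^sub>R x) -` A"
  have "emeasure lborel A = ennreal (\<bar>c\<bar> ^ DIM('a)) * emeasure lborel ?V"
    using assms(1) by (subst lborel_affine[of c t]) (auto simp: emeasure_density_const emeasure_distr)
  then have "2 ^ DIM('a) * emeasure lborel A = (ennreal (2 ^ DIM('a)) * ennreal (\<bar>c\<bar> ^ DIM('a))) * emeasure lborel ?V"
    by (simp add: mult.assoc ennreal_power[symmetric])
  also have "ennreal (2 ^ DIM('a)) * ennreal (\<bar>c\<bar> ^ DIM('a)) = ennreal ((2 * c) ^ DIM('a))"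
    using assms(1) by (simp add: ennreal_mult[symmetric] power_mult_distrib)
  finally have eq: "2 ^ DIM('a) * emeasure lborel A = ennreal ((2 * c) ^ DIM('a)) * emeasure lborel ?V" .
  have "1 \<le> ennreal ((2 * c) ^ DIM('a))"
    using one_le_power[of "2 * c" "DIM('a)"] assms(1) by (simp del: one_le_power)
  then show ?thesis
    unfolding eq using mult_right_mono[of 1 _ "emeasure lborel ?V"] by simp
qed

text \<open>
  For fixed \<open>x\<close>, the point \<open>(1 - s) x + s y\<close> is a dilation of \<open>y\<close> by \<open>s \<ge> 1/2\<close>, so the density
  bound on the law of \<open>y\<close> grows by at most the factor \<open>2\<^sup>d\<close>. Convexity keeps the intermediate points
  in \<open>B\<close>.
\<close>
lemma emeasure_interpolation_le_half:
  fixes p q :: "'a::euclidean_space measure"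
  assumes p: "sets p = sets borel" "finite_measure p" "\<And>A. A \<in> sets borel \<Longrightarrow> emeasure p A \<le> c * emeasure lborel (A \<inter> B)"
    and q: "sets q = sets borel" "finite_measure q" "emeasure q (- B) = 0"
    and B[measurable]: "B \<in> sets borel" and "convex B"
    and s: "1/2 \<le> s" "s \<le> 1"
    and A[measurable]: "A \<in> sets borel"
  shows "emeasure (q \<Otimes>\<^sub>M p) {z. (1 - s) *\<^sub>R fst z + s *\<^sub>R snd z \<in> A} \<le>
           (c * (2 ^ DIM('a) * emeasure lborel (A \<inter> B))) * emeasure q UNIV"
proof -
  note [measurable_cong] = p(1) q(1)
  interpret p: finite_measure p by fact
  interpret q: finite_measure q by fact
  have sp: "space p = UNIV" "space q = UNIV"
    using p(1) q(1) by (auto dest: sets_eq_imp_space_eq)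
  have "{z \<in> space (q \<Otimes>\<^sub>M p). (1 - s) *\<^sub>R fst z + s *\<^sub>R snd z \<in> A} \<in> sets (q \<Otimes>\<^sub>M p)"
    by measurable
  then have "emeasure (q \<Otimes>\<^sub>M p) {z. (1 - s) *\<^sub>R fst z + s *\<^sub>R snd z \<in> A} =
      (\<integral>\<^sup>+x. emeasure p ((\<lambda>y. (1 - s) *\<^sub>R x + s *\<^sub>R y) -` A) \<partial>q)"
    by (subst p.emeasure_pair_measure_alt) (auto simp: space_pair_measure sp vimage_def)
  also have "\<dots> \<le> (\<integral>\<^sup>+x. c * (2 ^ DIM('a) * emeasure lborel (A \<inter> B)) \<partial>q)"
  proof (rule nn_integral_mono_AE)
    have "AE x in q. x \<in> B"
      using q(3) by (intro AE_I[of _ _ "- B"]) auto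
    then show "AE x in q. emeasure p ((\<lambda>y. (1 - s) *\<^sub>R x + s *\<^sub>R y) -` A) \<le>
                 c * (2 ^ DIM('a) * emeasure lborel (A \<inter> B))"
    proof eventually_elim
      case (elim x)
      let ?h = "\<lambda>y. (1 - s) *\<^sub>R x + s *\<^sub>R y"
      have h: "?h -` X \<in> sets borel" if "X \<in> sets borel" for X
        using measurable_sets[of ?h borel borel X] that by simp
      have "emeasure p (?h -` A) \<le> c * emeasure lborel (?h -` A \<inter> B)"
        by (intro p h) simp
      also have "?h -` A \<inter> B \<subseteq> ?h -` (A \<inter> B)"
        using elim \<open>convex B\<close> s by (auto intro!: convexD)
      then have "emeasure lborel (?h -` A \<inter> B) \<le> emeasure lborel (?h -` (A \<inter> B))"
        by (intro emeasure_mono) (auto intro: h)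
      also have "\<dots> \<le> 2 ^ DIM('a) * emeasure lborel (A \<inter> B)"
        using s by (intro emeasure_lborel_affine_vimage_le) auto
      finally show ?case by (simp add: mult_left_mono)
    qed
  qed
  also have "\<dots> = (c * (2 ^ DIM('a) * emeasure lborel (A \<inter> B))) * emeasure q UNIV"
    by (simp add: sp)
  finally show ?thesis .
qed

text \<open>
  One of the two coefficients \<open>s\<close> and \<open>1 - s\<close> is at least \<open>1/2\<close>, and the two marginals play
  symmetric roles.
\<close>
lemma emeasure_interpolation_le:
  fixes p q :: "'a::euclidean_space measure"
  assumes p: "sets p = sets borel" "finite_measure p" "\<And>A. A \<in> sets borel \<Longrightarrow> emeasure p A \<le> c * emeasure lborel (A \<inter> B)"
    and q: "sets q = sets borel" "finite_measure q" "\<And>A. A \<in> sets borel \<Longrightarrow> emeasure q A \<le> c * emeasure lborel (A \<inter> B)"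
    and mass: "emeasure p UNIV = m" "emeasure q UNIV = m"
    and B: "B \<in> sets borel" "convex B"
    and s: "0 \<le> s" "s \<le> 1"
    and A: "A \<in> sets borel"
  shows "emeasure (q \<Otimes>\<^sub>M p) {z. (1 - s) *\<^sub>R fst z + s *\<^sub>R snd z \<in> A} \<le>
           (c * (2 ^ DIM('a) * emeasure lborel (A \<inter> B))) * m"
proof (cases "1/2 \<le> s")
  case True
  have "emeasure q (- B) = 0"
    using q(3)[of "- B"] B by auto
  then show ?thesis
    using emeasure_interpolation_le_half[OF p q(1,2) _ B True s(2) A] mass by simp
next
  case False
  note [measurable_cong] = p(1) q(1)
  note [measurable] = A
  interpret p: finite_measure p by fact
  interpret q: finite_measure q by fact
  interpret pair_sigma_finite q p ..
  have sp: "space p = UNIV" "space q = UNIV"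
    using p(1) q(1) by (auto dest: sets_eq_imp_space_eq)
  have 0: "emeasure p (- B) = 0"
    using p(3)[of "- B"] B by auto
  have "{z \<in> space (q \<Otimes>\<^sub>M p). (1 - s) *\<^sub>R fst z + s *\<^sub>R snd z \<in> A} \<in> sets (q \<Otimes>\<^sub>M p)"
    by measurable
  then have "emeasure (q \<Otimes>\<^sub>M p) {z. (1 - s) *\<^sub>R fst z + s *\<^sub>R snd z \<in> A} =
      emeasure (p \<Otimes>\<^sub>M q) {z. (1 - (1 - s)) *\<^sub>R fst z + (1 - s) *\<^sub>R snd z \<in> A}"
    by (subst distr_pair_swap, subst emeasure_distr)
       (auto simp: space_pair_measure sp vimage_def split_beta' add.commute)
  also have "\<dots> \<le> (c * (2 ^ DIM('a) * emeasure lborel (A \<inter> B))) * m"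
    using emeasure_interpolation_le_half[OF q p(1,2) 0 B _ _ A, of "1 - s"] False s mass by simp
  finally show ?thesis .
qed

text \<open>
  Here \<open>\<nu> = \<rho> - b + a\<close>. Under the independent coupling of \<open>b\<close> and \<open>a\<close>, let \<open>\<eta> k\<close> be the law of the
  \<open>k\<close>-th of the \<open>N + 1\<close> equally spaced points on the segment from source to target, so that
  \<open>\<eta> 0 = b\<close> and \<open>\<eta> N = a\<close>. The plan moves \<open>\<eta> k\<close> to \<open>\<eta> (k + 1)\<close> for all \<open>k < N\<close> and keeps the rest
  \<open>\<rho> - \<eta> 0 - \<dots> - \<eta> (N - 1)\<close> in place. Its second marginal telescopes to \<open>\<rho> - \<eta> 0 + \<eta> N\<close>.
\<close>
lemma d_infinity_le_by_chain:
  fixes \<rho> \<nu> a b :: "'a::euclidean_space measure" and N :: nat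
  assumes a: "sets a = sets borel" "finite_measure a" "\<And>A. A \<in> sets borel \<Longrightarrow> emeasure a A \<le> c * emeasure lborel (A \<inter> B)"
    and b: "sets b = sets borel" "finite_measure b" "\<And>A. A \<in> sets borel \<Longrightarrow> emeasure b A \<le> c * emeasure lborel (A \<inter> B)"
    and mass: "emeasure a UNIV = emeasure b UNIV"
    and B: "B \<in> sets borel" "convex B" and diam: "\<And>x y. x \<in> B \<Longrightarrow> y \<in> B \<Longrightarrow> norm (x - y) \<le> D" and "0 \<le> D"
    and N: "N > 0"
    and \<rho>: "sets \<rho> = sets borel" "finite_measure \<rho>"
    and ge: "\<And>A. A \<in> sets borel \<Longrightarrow> of_nat N * (c * (2 ^ DIM('a) * emeasure lborel (A \<inter> B))) \<le> emeasure \<rho> A"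
    and \<nu>: "sets \<nu> = sets borel"
    and balance: "\<And>A. A \<in> sets borel \<Longrightarrow> emeasure \<nu> A + emeasure b A = emeasure \<rho> A + emeasure a A"
  shows "d_infinity \<rho> \<nu> \<le> ereal (D / N)"
proof -
  interpret a: finite_measure a by fact
  interpret b: finite_measure b by fact
  interpret \<rho>: finite_measure \<rho> by fact
  note [measurable_cong] = a(1) b(1) \<rho>(1) \<nu>
  note [measurable] = B(1)
  have sp: "space a = UNIV" "space b = UNIV" "space \<rho> = UNIV" "space \<nu> = UNIV"
    using a(1) b(1) \<rho>(1) \<nu> by (auto dest: sets_eq_imp_space_eq)
  define m where "m = emeasure a UNIV"
  have m: "emeasure a UNIV = m" "emeasure b UNIV = m" "m \<noteq> \<infinity>"
    using mass a.emeasure_finite[of UNIV] by (auto simp: m_def)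
  define \<gamma> where "\<gamma> = scale_measure (inverse m) (b \<Otimes>\<^sub>M a)"
  have sets_\<gamma>[measurable_cong]: "sets \<gamma> = sets (borel \<Otimes>\<^sub>M borel)"
    unfolding \<gamma>_def by (simp cong: sets_pair_measure_cong add: a(1) b(1))
  have sp_\<gamma>: "space \<gamma> = UNIV"
    using sets_eq_imp_space_eq[OF sets_\<gamma>] by (simp add: space_pair_measure)
  define h where "h k z = (1 - real k / real N) *\<^sub>R fst z + (real k / real N) *\<^sub>R snd z" for k and z :: "'a \<times> 'a"
  have h[measurable]: "h k \<in> borel_measurable (borel \<Otimes>\<^sub>M borel)" for k
    unfolding h_def by measurable
  define \<eta> where "\<eta> k = distr \<gamma> borel (h k)" for k
  have *: "inverse m * (x * m) = x" if "m \<noteq> 0" for x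
  proof -
    have "inverse m * m = 1"
      using that m(3) ennreal_divide_self[of m] by (simp add: divide_ennreal_def mult.commute less_top)
    then show ?thesis
      by (simp add: mult.left_commute[of _ x])
  qed
  have cancel: "inverse m * (x * m) \<le> x" for x
    using *[of x] by (cases "m = 0") auto
  \<comment> \<open>If \<open>m = 0\<close>, then \<open>inverse m = \<infinity>\<close> and the identity holds because \<open>x = 0\<close>.\<close>
  have cancel': "inverse m * (x * m) = x" if "x \<le> m" for x
    using *[of x] that by (cases "m = 0") auto
  have eta: "emeasure (\<eta> k) A = inverse m * emeasure (b \<Otimes>\<^sub>M a) {z. h k z \<in> A}" if "A \<in> sets borel" for A k
  proof -
    have "emeasure (\<eta> k) A = emeasure \<gamma> {z. h k z \<in> A}"
      using that unfolding \<eta>_def by (subst emeasure_distr) (auto simp: sp_\<gamma> vimage_def)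
    then show ?thesis by (simp add: \<gamma>_def)
  qed
  have eta_le: "emeasure (\<eta> k) A \<le> c * (2 ^ DIM('a) * emeasure lborel (A \<inter> B))" if "A \<in> sets borel" "k \<le> N" for A k
  proof -
    have "emeasure (\<eta> k) A \<le> inverse m * ((c * (2 ^ DIM('a) * emeasure lborel (A \<inter> B))) * m)"
      unfolding eta[OF that(1)] h_def using that N
      by (intro mult_left_mono emeasure_interpolation_le a b m B) auto
    also note cancel
    finally show ?thesis .
  qed
  have eta_0: "emeasure (\<eta> 0) A = emeasure b A" if "A \<in> sets borel" for A
  proof -
    have "emeasure (b \<Otimes>\<^sub>M a) {z. h 0 z \<in> A} = emeasure (b \<Otimes>\<^sub>M a) (A \<times> UNIV)"
      by (intro arg_cong[where f="emeasure _"]) (auto simp: h_def)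
    also have "\<dots> = emeasure b A * m"
      using that by (subst a.emeasure_pair_measure_Times) (auto simp: m)
    finally show ?thesis
      using that emeasure_space[of b A] m by (simp add: eta cancel' sp)
  qed
  have eta_N: "emeasure (\<eta> N) A = emeasure a A" if "A \<in> sets borel" for A
  proof -
    have "emeasure (b \<Otimes>\<^sub>M a) {z. h N z \<in> A} = emeasure (b \<Otimes>\<^sub>M a) (UNIV \<times> A)"
      using N by (intro arg_cong[where f="emeasure _"]) (auto simp: h_def)
    also have "\<dots> = emeasure a A * m"
      using that by (subst a.emeasure_pair_measure_Times) (auto simp: m mult.commute)
    finally show ?thesis
      using that emeasure_space[of a A] m by (simp add: eta cancel' sp)
  qed
  obtain S where S: "sets S = sets borel"
      "\<And>A. A \<in> sets borel \<Longrightarrow> emeasure S A = (\<Sum>k<N. emeasure (\<eta> k) A)"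
    by (rule finite_sum_measure_exists[of "{..<N}" \<eta>]) (auto simp: \<eta>_def)
  have S_le: "emeasure S A \<le> emeasure \<rho> A" if "A \<in> sets borel" for A
  proof -
    have "emeasure S A \<le> (\<Sum>k<N. c * (2 ^ DIM('a) * emeasure lborel (A \<inter> B)))"
      unfolding S(2)[OF that] using that by (intro sum_mono eta_le) auto
    also have "\<dots> \<le> emeasure \<rho> A"
      using ge[OF that] by simp
    finally show ?thesis .
  qed
  have fin_S: "finite_measure S"
  proof
    show "emeasure S (space S) \<noteq> \<infinity>"
      using S_le[of UNIV] \<rho>.emeasure_finite[of UNIV] sets_eq_imp_space_eq[OF S(1)] by (auto simp: top_unique)
  qed
  define R where "R = diff_measure \<rho> S"
  have sets_R[measurable_cong]: "sets R = sets borel"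
    by (simp add: R_def \<rho>(1))
  have R: "emeasure R A + emeasure S A = emeasure \<rho> A" if "A \<in> sets borel" for A
    using that S_le[OF that] emeasure_diff_measure[OF \<rho>(2) fin_S, of A] S S_le \<rho>(1)
    by (simp add: R_def diff_add_self_ennreal)
  define J where "J k = (if k < N then distr \<gamma> borel (\<lambda>z. (h k z, h (Suc k) z))
      else distr R borel (\<lambda>x. (x, x)))" for k
  obtain \<pi> where \<pi>: "sets \<pi> = sets borel"
      "\<And>A. A \<in> sets borel \<Longrightarrow> emeasure \<pi> A = (\<Sum>k\<le>N. emeasure (J k) A)"
    by (rule finite_sum_measure_exists[of "{..N}" J]) (auto simp: J_def)
  have pi: "emeasure \<pi> A = (\<Sum>k<N. emeasure (distr \<gamma> borel (\<lambda>z. (h k z, h (Suc k) z))) A)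
      + emeasure (distr R borel (\<lambda>x. (x, x))) A" if "A \<in> sets borel" for A
    unfolding \<pi>(2)[OF that] by (simp add: J_def lessThan_Suc_atMost[symmetric])
  have sp_\<pi>: "space \<pi> = UNIV" and sp_R: "space R = UNIV"
    using sets_eq_imp_space_eq[OF \<pi>(1)] sets_eq_imp_space_eq[OF sets_R] by auto
  have pi_proj[measurable]: "fst \<in> \<pi> \<rightarrow>\<^sub>M borel" "snd \<in> \<pi> \<rightarrow>\<^sub>M borel"
    unfolding measurable_cong_sets[OF \<pi>(1) refl] borel_prod[symmetric] by measurable
  have hh[measurable]: "(\<lambda>z. (h k z, h (Suc k) z)) \<in> \<gamma> \<rightarrow>\<^sub>M borel" for k
    unfolding borel_prod[symmetric] by measurable
  have dd[measurable]: "(\<lambda>x. (x, x)) \<in> R \<rightarrow>\<^sub>M borel"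
    unfolding borel_prod[symmetric] by measurable
  have "distr \<pi> borel fst = \<rho>"
  proof (rule measure_eqI)
    fix A assume "A \<in> sets (distr \<pi> borel fst)"
    then have A[measurable]: "A \<in> sets borel" by simp
    have A': "A \<times> UNIV \<in> sets (borel :: ('a \<times> 'a) measure)"
      unfolding borel_prod[symmetric] by measurable
    have "emeasure (distr \<pi> borel fst) A = emeasure \<pi> (A \<times> UNIV)"
      by (subst emeasure_distr) (auto simp: sp_\<pi> intro!: arg_cong[where f="emeasure \<pi>"])
    also have "\<dots> = (\<Sum>k<N. emeasure (\<eta> k) A) + emeasure R A"
      unfolding pi[OF A'] \<eta>_def using A A'
      by (intro arg_cong2[where f="(+)"] sum.cong)
         (auto simp: emeasure_distr sp_\<gamma> sp_R vimage_def)
    also have "\<dots> = emeasure \<rho> A"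
      using R[OF A] S(2)[OF A] by (simp add: add.commute)
    finally show "emeasure (distr \<pi> borel fst) A = emeasure \<rho> A" .
  qed (simp add: \<rho>(1))
  moreover have "distr \<pi> borel snd = \<nu>"
  proof (rule measure_eqI)
    fix A assume "A \<in> sets (distr \<pi> borel snd)"
    then have A[measurable]: "A \<in> sets borel" by simp
    have A': "UNIV \<times> A \<in> sets (borel :: ('a \<times> 'a) measure)"
      unfolding borel_prod[symmetric] by measurable
    have "emeasure (distr \<pi> borel snd) A = emeasure \<pi> (UNIV \<times> A)"
      by (subst emeasure_distr) (auto simp: sp_\<pi> intro!: arg_cong[where f="emeasure \<pi>"])
    also have "\<dots> = (\<Sum>k<N. emeasure (\<eta> (Suc k)) A) + emeasure R A"
      unfolding pi[OF A'] \<eta>_def using A A'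
      by (intro arg_cong2[where f="(+)"] sum.cong)
         (auto simp: emeasure_distr sp_\<gamma> sp_R vimage_def)
    finally have X: "emeasure (distr \<pi> borel snd) A = (\<Sum>k<N. emeasure (\<eta> (Suc k)) A) + emeasure R A" .
    \<comment> \<open>Adding \<open>b = \<eta> 0\<close> completes the shifted sum; subtraction is avoided until the end.\<close>
    have "emeasure (distr \<pi> borel snd) A + emeasure b A = (\<Sum>k<Suc N. emeasure (\<eta> k) A) + emeasure R A"
      unfolding X sum.lessThan_Suc_shift using eta_0[OF A] by (simp add: ac_simps)
    also have "\<dots> = emeasure \<rho> A + emeasure a A"
      using R[OF A] S(2)[OF A] eta_N[OF A] by (simp add: ac_simps)
    also have "\<dots> = emeasure \<nu> A + emeasure b A"
      using balance[OF A] by simp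
    finally show "emeasure (distr \<pi> borel snd) A = emeasure \<nu> A"
      using b.emeasure_finite[of A] by (auto simp: add.commute[of _ "emeasure b A"] ennreal_add_left_cancel)
  qed (simp add: \<nu>)
  ultimately have "\<pi> \<in> transport_plans \<rho> \<nu>"
    using \<pi>(1) by (simp add: transport_plans_def)
  moreover have "measure_support \<pi> \<subseteq> {z. norm (fst z - snd z) \<le> D / N}"
  proof -
    let ?U = "{z :: 'a \<times> 'a. D / N < norm (fst z - snd z)}"
    have op: "open ?U"
      by (intro open_Collect_less continuous_intros)
    then have U[measurable]: "?U \<in> sets borel" by simp
    have "emeasure (distr \<gamma> borel (\<lambda>z. (h k z, h (Suc k) z))) ?U = 0" for k
    proof -
      have "h k z - h (Suc k) z = (1 / N) *\<^sub>R (fst z - snd z)" for z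
        using N by (simp add: h_def algebra_simps add_divide_distrib)
      then have *: "norm (h k z - h (Suc k) z) = norm (fst z - snd z) / N" for z
        by simp
      have "emeasure a (- B) = 0" "emeasure b (- B) = 0"
        using a(3)[of "- B"] b(3)[of "- B"] B by auto
      moreover have "{z. D / N < norm (h k z - h (Suc k) z)} \<subseteq> (- B) \<times> UNIV \<union> UNIV \<times> (- B)"
      proof (safe; rule ccontr; clarsimp simp: *)
        fix x y assume "x \<in> B" "y \<in> B" "D / N < norm (x - y) / N"
        then show False
          using diam[of x y] N by (simp add: divide_less_cancel)
      qed
      then have "emeasure (b \<Otimes>\<^sub>M a) {z. D / N < norm (h k z - h (Suc k) z)}
          \<le> emeasure (b \<Otimes>\<^sub>M a) ((- B) \<times> UNIV \<union> UNIV \<times> (- B))"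
        by (intro emeasure_mono) auto
      moreover have "emeasure (b \<Otimes>\<^sub>M a) ((- B) \<times> UNIV \<union> UNIV \<times> (- B)) \<le>
          emeasure (b \<Otimes>\<^sub>M a) ((- B) \<times> UNIV) + emeasure (b \<Otimes>\<^sub>M a) (UNIV \<times> (- B))"
        by (intro emeasure_subadditive) auto
      ultimately have "emeasure (b \<Otimes>\<^sub>M a) {z. D / N < norm (h k z - h (Suc k) z)} = 0"
        by (simp add: a.emeasure_pair_measure_Times)
      then have "emeasure \<gamma> {z. D / N < norm (h k z - h (Suc k) z)} = 0"
        by (simp add: \<gamma>_def)
      then show ?thesis
        by (subst emeasure_distr) (auto simp: sp_\<gamma> vimage_def)
    qed
    moreover have "emeasure (distr R borel (\<lambda>x. (x, x))) ?U = 0"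
    proof -
      have "(\<lambda>x. (x, x)) -` ?U = ({} :: 'a set)"
        using \<open>0 \<le> D\<close> by (auto simp: not_less)
      then show ?thesis
        by (simp add: emeasure_distr)
    qed
    ultimately have "emeasure \<pi> ?U = 0"
      by (simp add: pi)
    then show ?thesis
      using op by (fastforce simp: measure_support_def not_less)
  qed
  ultimately show ?thesis
    unfolding d_infinity_def by (intro INF_lower2[of \<pi>] SUP_least) auto
qed

section \<open>The energy of opposite perturbations\<close>

lemma energy_density_eq_integral:
  fixes W :: "'a::euclidean_space \<Rightarrow> ereal" and h :: "'a \<Rightarrow> real"
  assumes \<rho>: "sets \<rho> = sets borel" "prob_space \<rho>"
    and [measurable]: "W \<in> borel_measurable borel" "h \<in> borel_measurable borel"
    and fin: "(\<integral>\<^sup>+z. e2ennreal \<bar>W (fst z - snd z)\<bar> \<partial>(\<rho> \<Otimes>\<^sub>M \<rho>)) < \<infinity>"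
    and h: "\<And>x. 0 \<le> h x" "\<And>x. h x \<le> K"
  shows "energy W (density \<rho> h) =
    ereal (1/2 * (\<integral>z. h (fst z) * h (snd z) * real_of_ereal (W (fst z - snd z)) \<partial>(\<rho> \<Otimes>\<^sub>M \<rho>)))"
proof -
  note [measurable_cong] = \<rho>(1)
  interpret \<rho>: prob_space \<rho> by fact
  have "(\<integral>\<^sup>+x. ennreal (h x) \<partial>\<rho>) \<le> (\<integral>\<^sup>+x. ennreal K \<partial>\<rho>)"
    using h by (intro nn_integral_mono ennreal_leI)
  also have "\<dots> < \<infinity>" by (simp add: \<rho>.emeasure_space_1)
  finally interpret \<mu>: finite_measure "density \<rho> h"
    by (intro finite_measureI) (simp add: emeasure_density cong: nn_integral_cong)
  have prod: "density \<rho> h \<Otimes>\<^sub>M density \<rho> h = density (\<rho> \<Otimes>\<^sub>M \<rho>) (\<lambda>z. ennreal (h (fst z) * h (snd z)))"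
    using h by (subst pair_measure_density)
      (auto simp: split_beta' ennreal_mult' intro: \<mu>.sigma_finite_measure_axioms \<rho>.sigma_finite_measure_axioms)
  have "(\<integral>\<^sup>+z. e2ennreal \<bar>W (fst z - snd z)\<bar> \<partial>(density \<rho> h \<Otimes>\<^sub>M density \<rho> h)) =
      (\<integral>\<^sup>+z. ennreal (h (fst z) * h (snd z)) * e2ennreal \<bar>W (fst z - snd z)\<bar> \<partial>(\<rho> \<Otimes>\<^sub>M \<rho>))"
    unfolding prod by (rule nn_integral_density) auto
  also have "\<dots> \<le> (\<integral>\<^sup>+z. ennreal (K * K) * e2ennreal \<bar>W (fst z - snd z)\<bar> \<partial>(\<rho> \<Otimes>\<^sub>M \<rho>))"
    using h order_trans[OF h(1) h(2)] by (intro nn_integral_mono mult_right_mono ennreal_leI mult_mono) auto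
  also have "\<dots> = ennreal (K * K) * (\<integral>\<^sup>+z. e2ennreal \<bar>W (fst z - snd z)\<bar> \<partial>(\<rho> \<Otimes>\<^sub>M \<rho>))"
    by (rule nn_integral_cmult) auto
  also have "\<dots> < \<infinity>"
    using fin by (simp add: ennreal_mult_less_top)
  finally have "(\<integral>\<^sup>+z. e2ennreal \<bar>W (fst z - snd z)\<bar> \<partial>(density \<rho> h \<Otimes>\<^sub>M density \<rho> h)) < \<infinity>" .
  then have "energy W (density \<rho> h) =
    ereal (1/2 * (\<integral>z. real_of_ereal (W (fst z - snd z)) \<partial>(density \<rho> h \<Otimes>\<^sub>M density \<rho> h)))"
    using \<rho>(1) by (intro energy_eq_integral) (auto intro: \<mu>.sigma_finite_measure_axioms)
  also have "(\<integral>z. real_of_ereal (W (fst z - snd z)) \<partial>(density \<rho> h \<Otimes>\<^sub>M density \<rho> h)) =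
      (\<integral>z. h (fst z) * h (snd z) * real_of_ereal (W (fst z - snd z)) \<partial>(\<rho> \<Otimes>\<^sub>M \<rho>))"
    unfolding prod using h by (subst integral_density) auto
  finally show ?thesis .
qed

text \<open>
  The terms linear in \<open>t\<close> cancel in the sum of the two energies, which leaves twice the energy
  of \<open>\<rho>\<close> plus the negative quadratic term.
\<close>
lemma energy_decreases_along_perturbation:
  fixes W :: "'a::euclidean_space \<Rightarrow> ereal" and u :: "'a \<Rightarrow> real"
  assumes \<rho>: "sets \<rho> = sets borel" "prob_space \<rho>"
    and [measurable]: "W \<in> borel_measurable borel" "u \<in> borel_measurable borel"
    and fin: "(\<integral>\<^sup>+z. e2ennreal \<bar>W (fst z - snd z)\<bar> \<partial>(\<rho> \<Otimes>\<^sub>M \<rho>)) < \<infinity>"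
    and t: "t \<noteq> 0" "\<And>x. \<bar>t * u x\<bar> \<le> 1"
    and neg: "(\<integral>z. u (fst z) * u (snd z) * real_of_ereal (W (fst z - snd z)) \<partial>(\<rho> \<Otimes>\<^sub>M \<rho>)) < 0"
  shows "energy W (density \<rho> (\<lambda>x. ennreal (1 + t * u x))) < energy W \<rho> \<or>
         energy W (density \<rho> (\<lambda>x. ennreal (1 - t * u x))) < energy W \<rho>"
proof -
  note [measurable_cong] = \<rho>(1)
  interpret \<rho>: prob_space \<rho> by fact
  let ?w = "\<lambda>z. real_of_ereal (W (fst z - snd z))"
  have w: "integrable (\<rho> \<Otimes>\<^sub>M \<rho>) ?w"
    using fin by (intro integrable_real_of_ereal) auto
  \<comment> \<open>The bound 2 covers all the weights that occur, \<open>t u\<close> and \<open>1 \<plusminus> t u\<close>.\<close>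
  have int: "integrable (\<rho> \<Otimes>\<^sub>M \<rho>) (\<lambda>z. p (fst z) * q (snd z) * ?w z)"
    if [measurable]: "p \<in> borel_measurable borel" "q \<in> borel_measurable borel"
      and p: "\<And>x. \<bar>p x\<bar> \<le> 2" and q: "\<And>x. \<bar>q x\<bar> \<le> 2" for p q :: "'a \<Rightarrow> real"
  proof (rule Bochner_Integration.integrable_bound)
    show "integrable (\<rho> \<Otimes>\<^sub>M \<rho>) (\<lambda>z. 4 * ?w z)" using w by simp
    show "AE z in \<rho> \<Otimes>\<^sub>M \<rho>. norm (p (fst z) * q (snd z) * ?w z) \<le> norm (4 * ?w z)"
    proof (intro AE_I2)
      show "norm (p (fst z) * q (snd z) * ?w z) \<le> norm (4 * ?w z)" for z
        unfolding norm_mult using mult_mono[OF p[of "fst z"] q[of "snd z"]]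
        by (intro mult_right_mono) (auto simp: real_of_ereal_pos)
    qed
  qed measurable
  let ?h = "\<lambda>s x. 1 + s * (t * u x)"
  define E where "E s = (\<integral>z. ?h s (fst z) * ?h s (snd z) * ?w z \<partial>(\<rho> \<Otimes>\<^sub>M \<rho>))" for s :: real
  have h: "0 \<le> ?h s x" "?h s x \<le> 2" if "\<bar>s\<bar> \<le> 1" for s x
  proof -
    have "\<bar>s * (t * u x)\<bar> \<le> 1 * 1"
      unfolding abs_mult[of s] using that t(2)[of x] by (intro mult_mono) auto
    then show "0 \<le> ?h s x" "?h s x \<le> 2" by auto
  qed
  have energy: "energy W (density \<rho> (?h s)) = ereal (1/2 * E s)" if "\<bar>s\<bar> \<le> 1" for s
    unfolding E_def using \<rho> fin h[OF that] by (intro energy_density_eq_integral[where K=2]) auto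
  have "density \<rho> (?h 0) = \<rho>" by (simp add: density_1)
  then have E0: "energy W \<rho> = ereal (1/2 * E 0)"
    using energy[of 0] by simp
  have "E 1 + E (-1) = (\<integral>z. ?h 1 (fst z) * ?h 1 (snd z) * ?w z + ?h (-1) (fst z) * ?h (-1) (snd z) * ?w z \<partial>(\<rho> \<Otimes>\<^sub>M \<rho>))"
    unfolding E_def using h[of 1] h[of "-1"]
    by (intro Bochner_Integration.integral_add[symmetric] int) (auto simp: abs_le_iff intro: order_trans[OF _ h(1)])
  also have "\<dots> = (\<integral>z. 2 * (1 * 1 * ?w z) + 2 * ((t * u (fst z)) * (t * u (snd z)) * ?w z) \<partial>(\<rho> \<Otimes>\<^sub>M \<rho>))"
    by (intro Bochner_Integration.integral_cong) (auto simp: algebra_simps)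
  also have "\<dots> = 2 * E 0 + 2 * (\<integral>z. (t * u (fst z)) * (t * u (snd z)) * ?w z \<partial>(\<rho> \<Otimes>\<^sub>M \<rho>))"
    using w int[of "\<lambda>x. t * u x" "\<lambda>x. t * u x"] order_trans[OF t(2), of 2]
    by (subst Bochner_Integration.integral_add) (auto simp: E_def)
  also have "(\<integral>z. (t * u (fst z)) * (t * u (snd z)) * ?w z \<partial>(\<rho> \<Otimes>\<^sub>M \<rho>)) =
      (t * t) * (\<integral>z. u (fst z) * u (snd z) * ?w z \<partial>(\<rho> \<Otimes>\<^sub>M \<rho>))"
    by (subst integral_mult_right_zero[symmetric]) (simp add: ac_simps)
  also have "2 * E 0 + 2 * \<dots> < 2 * E 0"
  proof -
    have "0 < t * t" using t(1) by (auto simp: zero_less_mult_iff)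
    from mult_pos_neg[OF this neg] show ?thesis by simp
  qed
  finally have "E 1 < E 0 \<or> E (-1) < E 0" by auto
  then show ?thesis
    using energy[of 1] energy[of "-1"] E0 by auto
qed

text \<open>
  This passes from \<open>u \<rho>\<close> to \<open>f dx\<close> in double integrals. The two signed measures coincide because
  they have the same total variation measure and the same sign; the signs
  are absorbed into the kernel, where they are bounded.
\<close>
lemma double_integral_transfer:
  fixes u f :: "'a::euclidean_space \<Rightarrow> real"
  assumes \<rho>: "sets \<rho> = sets borel" "sigma_finite_measure \<rho>"
    and [measurable]: "u \<in> borel_measurable borel" "f \<in> borel_measurable borel"
    and eq: "density \<rho> (\<lambda>x. ennreal \<bar>u x\<bar>) = density lborel (\<lambda>x. ennreal \<bar>f x\<bar>)" (is "?L = ?R")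
    and fin: "finite_measure (density \<rho> (\<lambda>x. ennreal \<bar>u x\<bar>))"
    and sgn: "\<And>x. sgn (u x) = sgn (f x)"
  shows "w \<in> borel_measurable (borel \<Otimes>\<^sub>M borel) \<Longrightarrow>
      (\<integral>\<^sup>+z. ennreal (\<bar>u (fst z)\<bar> * \<bar>u (snd z)\<bar>) * w z \<partial>(\<rho> \<Otimes>\<^sub>M \<rho>)) =
      (\<integral>\<^sup>+z. ennreal (\<bar>f (fst z)\<bar> * \<bar>f (snd z)\<bar>) * w z \<partial>(lborel \<Otimes>\<^sub>M lborel))"
    and "k \<in> borel_measurable (borel \<Otimes>\<^sub>M borel) \<Longrightarrow>
      (\<integral>z. u (fst z) * u (snd z) * k z \<partial>(\<rho> \<Otimes>\<^sub>M \<rho>)) =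
      (\<integral>z. f (fst z) * f (snd z) * (k z :: real) \<partial>(lborel \<Otimes>\<^sub>M lborel))"
proof -
  note [measurable_cong] = \<rho>(1)
  interpret \<rho>: sigma_finite_measure \<rho> by fact
  interpret L: finite_measure ?L by fact
  have sf: "sigma_finite_measure ?R" "sigma_finite_measure ?L"
    using L.sigma_finite_measure_axioms eq by auto
  have pL: "?L \<Otimes>\<^sub>M ?L = density (\<rho> \<Otimes>\<^sub>M \<rho>) (\<lambda>z. ennreal (\<bar>u (fst z)\<bar> * \<bar>u (snd z)\<bar>))"
    using sf by (subst pair_measure_density) (auto simp: split_beta' ennreal_mult \<rho>)
  have pR: "?L \<Otimes>\<^sub>M ?L = density (lborel \<Otimes>\<^sub>M lborel) (\<lambda>z. ennreal (\<bar>f (fst z)\<bar> * \<bar>f (snd z)\<bar>))"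
    unfolding eq using sf by (subst pair_measure_density) (auto simp: split_beta' ennreal_mult sigma_finite_lborel)
  show "(\<integral>\<^sup>+z. ennreal (\<bar>u (fst z)\<bar> * \<bar>u (snd z)\<bar>) * w z \<partial>(\<rho> \<Otimes>\<^sub>M \<rho>)) =
      (\<integral>\<^sup>+z. ennreal (\<bar>f (fst z)\<bar> * \<bar>f (snd z)\<bar>) * w z \<partial>(lborel \<Otimes>\<^sub>M lborel))"
    if [measurable]: "w \<in> borel_measurable (borel \<Otimes>\<^sub>M borel)"
  proof -
    have "(\<integral>\<^sup>+z. ennreal (\<bar>u (fst z)\<bar> * \<bar>u (snd z)\<bar>) * w z \<partial>(\<rho> \<Otimes>\<^sub>M \<rho>)) = (\<integral>\<^sup>+z. w z \<partial>(?L \<Otimes>\<^sub>M ?L))"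
      unfolding pL by (rule nn_integral_density[symmetric]) measurable
    also have "\<dots> = (\<integral>\<^sup>+z. ennreal (\<bar>f (fst z)\<bar> * \<bar>f (snd z)\<bar>) * w z \<partial>(lborel \<Otimes>\<^sub>M lborel))"
      unfolding pR by (rule nn_integral_density) measurable
    finally show ?thesis .
  qed
  show "(\<integral>z. u (fst z) * u (snd z) * k z \<partial>(\<rho> \<Otimes>\<^sub>M \<rho>)) =
      (\<integral>z. f (fst z) * f (snd z) * k z \<partial>(lborel \<Otimes>\<^sub>M lborel))"
    if [measurable]: "k \<in> borel_measurable (borel \<Otimes>\<^sub>M borel)"
  proof -
    let ?k = "\<lambda>z. sgn (f (fst z)) * sgn (f (snd z)) * k z"
    have split: "u (fst z) * u (snd z) * k z = (\<bar>u (fst z)\<bar> * \<bar>u (snd z)\<bar>) *\<^sub>R ?k z"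
      "f (fst z) * f (snd z) * k z = (\<bar>f (fst z)\<bar> * \<bar>f (snd z)\<bar>) *\<^sub>R ?k z" for z
    proof -
      have "u x = \<bar>u x\<bar> * sgn (f x)" "f x = \<bar>f x\<bar> * sgn (f x)" for x
        using abs_mult_sgn[of "u x"] abs_mult_sgn[of "f x"] sgn[of x] by simp_all
      then show "u (fst z) * u (snd z) * k z = (\<bar>u (fst z)\<bar> * \<bar>u (snd z)\<bar>) *\<^sub>R ?k z"
        "f (fst z) * f (snd z) * k z = (\<bar>f (fst z)\<bar> * \<bar>f (snd z)\<bar>) *\<^sub>R ?k z"
        by (metis (no_types, opaque_lifting) mult.assoc mult.left_commute real_scaleR_def)+
    qed
    have "(\<integral>z. u (fst z) * u (snd z) * k z \<partial>(\<rho> \<Otimes>\<^sub>M \<rho>)) = (\<integral>z. ?k z \<partial>(?L \<Otimes>\<^sub>M ?L))"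
      unfolding pL split by (rule integral_density[symmetric]) auto
    also have "\<dots> = (\<integral>z. f (fst z) * f (snd z) * k z \<partial>(lborel \<Otimes>\<^sub>M lborel))"
      unfolding pR split by (rule integral_density) auto
    finally show ?thesis .
  qed
qed

section \<open>Perturbations supported in a ball\<close>

text \<open>
  Away from the null set \<open>N\<close> carrying the singular part, \<open>\<rho>\<close> is \<open>g dx\<close>.
\<close>
lemma density_eq_density_lborel_off_singular:
  fixes \<rho> :: "'a::euclidean_space measure" and g :: "'a \<Rightarrow> real" and \<phi> :: "'a \<Rightarrow> ennreal"
  assumes \<rho>: "sets \<rho> = sets borel" and \<sigma>: "sets \<sigma> = sets borel"
    and [measurable]: "g \<in> borel_measurable borel" "N \<in> sets borel" "\<phi> \<in> borel_measurable borel"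
    and N: "emeasure lborel N = 0" "emeasure \<sigma> (- N) = 0"
    and decomp: "\<And>A. A \<in> sets borel \<Longrightarrow>
      emeasure \<rho> A = (\<integral>\<^sup>+x. ennreal (g x) * indicator A x \<partial>lborel) + emeasure \<sigma> A"
    and \<phi>: "\<And>x. x \<in> N \<Longrightarrow> \<phi> x = 0"
  shows "density \<rho> \<phi> = density lborel (\<lambda>x. ennreal (g x) * \<phi> x)"
proof -
  note [measurable_cong] = \<rho> \<sigma>
  have *: "density \<rho> (indicator (- N)) = density lborel (\<lambda>x. ennreal (g x))"
  proof (rule measure_eqI)
    fix A assume "A \<in> sets (density \<rho> (indicator (- N)))"
    then have [measurable]: "A \<in> sets borel" by (simp add: \<rho>)
    have "emeasure (density \<rho> (indicator (- N))) A = (\<integral>\<^sup>+x. indicator (- N) x * indicator A x \<partial>\<rho>)"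
      by (rule emeasure_density) measurable
    also have "\<dots> = (\<integral>\<^sup>+x. indicator (A - N) x \<partial>\<rho>)"
      by (intro nn_integral_cong) (simp split: split_indicator)
    also have "\<dots> = emeasure \<rho> (A - N)"
      by (rule nn_integral_indicator) measurable
    also have "\<dots> = (\<integral>\<^sup>+x. ennreal (g x) * indicator (A - N) x \<partial>lborel) + emeasure \<sigma> (A - N)"
      by (rule decomp) simp
    also have "emeasure \<sigma> (A - N) = 0"
      using emeasure_mono[of "A - N" "- N" \<sigma>] N(2) by (auto simp: \<sigma>)
    also have "(\<integral>\<^sup>+x. ennreal (g x) * indicator (A - N) x \<partial>lborel) = (\<integral>\<^sup>+x. ennreal (g x) * indicator A x \<partial>lborel)"
    proof (rule nn_integral_cong_AE)
      have "AE x in lborel. x \<notin> N"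
        using N(1) by (intro AE_not_in) (auto simp: null_sets_def)
      then show "AE x in lborel. ennreal (g x) * indicator (A - N) x = ennreal (g x) * indicator A x"
        by eventually_elim (auto simp: indicator_def)
    qed
    finally show "emeasure (density \<rho> (indicator (- N))) A = emeasure (density lborel (\<lambda>x. ennreal (g x))) A"
      by (simp add: emeasure_density)
  qed (simp add: \<rho>)
  have "density \<rho> \<phi> = density \<rho> (\<lambda>x. indicator (- N) x * \<phi> x)"
    using \<phi> by (intro density_cong) (auto simp: indicator_def)
  also have "\<dots> = density (density \<rho> (indicator (- N))) \<phi>"
    by (rule density_density_eq[symmetric]) auto
  also have "\<dots> = density lborel (\<lambda>x. ennreal (g x) * \<phi> x)"
    unfolding * by (rule density_density_eq) auto
  finally show ?thesis .
qed

lemma energy_fun_cong_AE: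
  assumes "AE x in lborel. f x = h x"
  shows "energy_fun W f = energy_fun W h"
proof -
  have ae: "AE x in lebesgue. f x = h x"
    using assms by (rule AE_completion)
  have "ereal_integral lebesgue (\<lambda>y. W (x - y) * ereal (f y)) =
        ereal_integral lebesgue (\<lambda>y. W (x - y) * ereal (h y))" for x
    using ae by (intro ereal_integral_cong_AE) auto
  then show ?thesis
    unfolding energy_fun_def using ae
    by (intro arg_cong2[where f="(*)"] refl ereal_integral_cong_AE) auto
qed

lemma energy_fun_translate:
  fixes W :: "'a::euclidean_space \<Rightarrow> ereal"
  assumes [measurable]: "W \<in> borel_measurable borel" "f \<in> borel_measurable borel"
  shows "energy_fun W (\<lambda>x. f (v + x)) = energy_fun W f"
proof -
  have completion: "ereal_integral lebesgue h = ereal_integral lborel h" for h :: "'a \<Rightarrow> ereal"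
    by (simp add: ereal_integral_def nn_integral_completion)
  have shift: "ereal_integral lborel (\<lambda>x. h (v + x)) = ereal_integral lborel h"
    if [measurable]: "h \<in> borel_measurable borel" for h :: "'a \<Rightarrow> ereal"
  proof -
    have nn: "(\<integral>\<^sup>+x. k (v + x) \<partial>lborel) = (\<integral>\<^sup>+x. k x \<partial>lborel)"
      if [measurable]: "k \<in> borel_measurable borel" for k :: "'a \<Rightarrow> ennreal"
    proof -
      have "(\<integral>\<^sup>+x. k (v + x) \<partial>lborel) = (\<integral>\<^sup>+x. k x \<partial>distr lborel borel ((+) v))"
        by (rule nn_integral_distr[symmetric]) auto
      then show ?thesis unfolding lborel_distr_plus .
    qed
    show ?thesis
      unfolding ereal_integral_def
      using nn[of "\<lambda>x. e2ennreal (h x)"] nn[of "\<lambda>x. e2ennreal (- h x)"] by simp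
  qed
  let ?I = "\<lambda>x. ereal_integral lborel (\<lambda>y. W (x - y) * ereal (f y))"
  have [measurable]: "?I \<in> borel_measurable borel"
    unfolding ereal_integral_def by measurable
  have "ereal_integral lborel (\<lambda>y. W (x - y) * ereal (f (v + y))) = ?I (v + x)" for x
    using shift[of "\<lambda>y. W ((v + x) - y) * ereal (f y)"] by (simp add: algebra_simps)
  then show ?thesis
    unfolding energy_fun_def completion using shift[of "\<lambda>x. ?I x * ereal (f x)"] by simp
qed

text \<open>
  A set of diameter at most \<open>\<delta>\<close> lies in the closed ball of radius \<open>\<delta>\<close> about any of its points. The
  sphere is a null set, so the profile may be taken to vanish outside the open ball, and
  likewise on the given null set \<open>N\<close>.
\<close>
lemma concave_profile_on_ball:
  fixes W :: "'a::euclidean_space \<Rightarrow> ereal"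
  assumes [measurable]: "W \<in> borel_measurable borel"
    and conc: "linear_interpolation_concave W \<delta>"
    and [measurable]: "N \<in> sets borel" and N: "emeasure lborel N = 0"
  obtains f C where "f \<in> borel_measurable borel" "C > 0" "\<And>x. \<bar>f x\<bar> \<le> C"
    "\<And>x. x \<notin> ball z \<delta> - N \<Longrightarrow> f x = 0" "(\<integral>x. f x \<partial>lborel) = 0" "energy_fun W f < 0"
proof -
  obtain f0 C0 where f0: "f0 \<in> borel_measurable lebesgue" "AE x in lebesgue. \<bar>f0 x\<bar> \<le> C0"
      "\<not> (AE x in lebesgue. f0 x = 0)" "bounded (ess_support f0)" "diameter (ess_support f0) \<le> \<delta>"
      "(\<integral>x. f0 x \<partial>lebesgue) = 0" "energy_fun W f0 < 0"
    using conc unfolding linear_interpolation_concave_def by blast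
  have supp: "AE x in lebesgue. x \<notin> ess_support f0 \<longrightarrow> f0 x = 0"
  proof -
    let ?F = "{U. open U \<and> (AE x in lebesgue. x \<in> U \<longrightarrow> f0 x = 0)}"
    obtain F where F: "F \<subseteq> ?F" "countable F" "\<Union>F = \<Union>?F"
      by (rule Lindelof[of ?F]) auto
    have "AE x in lebesgue. \<forall>U\<in>F. x \<in> U \<longrightarrow> f0 x = 0"
      using F by (subst AE_ball_countable) auto
    then show ?thesis
      unfolding ess_support_def F(3)[symmetric] by eventually_elim auto
  qed
  have "ess_support f0 \<noteq> {}"
    using supp f0(3) by auto
  then obtain p where p: "p \<in> ess_support f0" by auto
  have cball: "ess_support f0 \<subseteq> cball p \<delta>"
    using diameter_bounded_bound[OF f0(4) p] f0(5) by force
  have "AE x in lebesgue. x \<notin> sphere p \<delta>"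
    using negligible_sphere[of p \<delta>] by (intro AE_not_in) (simp add: negligible_iff_null_sets)
  with supp have off_ball: "AE x in lebesgue. x \<notin> ball p \<delta> \<longrightarrow> f0 x = 0"
    by eventually_elim (use cball in auto)
  obtain f1 where f1[measurable]: "f1 \<in> borel_measurable borel" and f01: "AE x in lborel. f0 x = f1 x"
    using completion_ex_borel_measurable_real[OF f0(1)] by auto
  let ?G = "\<lambda>x. \<bar>f1 x\<bar> \<le> C0 \<and> (x \<notin> ball p \<delta> \<longrightarrow> f1 x = 0)"
  have good: "AE x in lborel. ?G x"
    using f0(2) off_ball f01 unfolding AE_completion_iff by eventually_elim auto
  define v where "v = p - z"
  have "AE x in distr lborel borel ((+) v). ?G x"
    using good unfolding lborel_distr_plus .
  then have good_shift: "AE x in lborel. ?G (v + x)"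
    by (subst (asm) AE_distr_iff) auto
  define f where "f x = (if x \<in> ball z \<delta> - N \<and> \<bar>f1 (v + x)\<bar> \<le> C0 then f1 (v + x) else 0)" for x
  have [measurable]: "ball z \<delta> \<in> sets borel"
    by simp
  have f[measurable]: "f \<in> borel_measurable borel"
    unfolding f_def by measurable
  have "AE x in lborel. x \<notin> N"
    using N by (intro AE_not_in) (auto simp: null_sets_def)
  with good_shift have ff1: "AE x in lborel. f x = f1 (v + x)"
  proof eventually_elim
    case (elim x)
    have "v + x \<in> ball p \<delta> \<longleftrightarrow> x \<in> ball z \<delta>"
      by (simp add: v_def dist_norm algebra_simps)
    with elim show ?case by (auto simp: f_def)
  qed
  show thesis
  proof
    show "f \<in> borel_measurable borel" by fact
    show "0 < \<bar>C0\<bar> + 1" by simp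
    show "\<bar>f x\<bar> \<le> \<bar>C0\<bar> + 1" for x
      by (auto simp: f_def)
    show "f x = 0" if "x \<notin> ball z \<delta> - N" for x
      using that by (auto simp: f_def)
    have "(\<integral>x. f x \<partial>lborel) = (\<integral>x. f1 (v + x) \<partial>lborel)"
      using ff1 by (intro integral_cong_AE) auto
    also have "\<dots> = (\<integral>x. f1 x \<partial>distr lborel borel ((+) v))"
      by (rule integral_distr[symmetric]) auto
    also have "\<dots> = (\<integral>x. f1 x \<partial>lebesgue)"
      unfolding lborel_distr_plus by (rule integral_completion[symmetric]) simp
    also have "\<dots> = (\<integral>x. f0 x \<partial>lebesgue)"
      using AE_completion[OF f01] f0(1)
      by (intro integral_cong_AE) (auto intro: measurable_completion)
    finally show "(\<integral>x. f x \<partial>lborel) = 0" using f0(6) by simp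
    have "energy_fun W f = energy_fun W (\<lambda>x. f1 (v + x))"
      by (rule energy_fun_cong_AE) (rule ff1)
    also have "\<dots> = energy_fun W f1"
      by (rule energy_fun_translate) auto
    also have "\<dots> = energy_fun W f0"
      by (rule energy_fun_cong_AE[symmetric]) (rule f01)
    finally show "energy_fun W f < 0" using f0(7) by simp
  qed
qed

text \<open>
  The competitor \<open>\<rho> + f dx\<close>, written as a density with respect to \<open>\<rho>\<close>. The measures \<open>a\<close> and \<open>b\<close>
  below are \<open>f\<^sup>+ dx\<close> and \<open>f\<^sup>- dx\<close>. The smallness assumption on \<open>f\<close> is exactly what makes the \<open>n\<close>
  intermediate masses of the chain fit below \<open>\<epsilon>\<^sub>0 dx\<close> on the ball, hence below \<open>\<rho>\<close>.
\<close>
lemma perturbation_admissible: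
  fixes \<rho> :: "'a::euclidean_space measure" and f g :: "'a \<Rightarrow> real"
  assumes \<rho>: "compact_prob \<rho>"
    and [measurable]: "f \<in> borel_measurable borel" "g \<in> borel_measurable borel" "N \<in> sets borel"
    and N: "emeasure lborel N = 0"
    and dens: "\<And>\<phi>. \<phi> \<in> borel_measurable borel \<Longrightarrow> (\<And>x. x \<in> N \<Longrightarrow> \<phi> x = 0) \<Longrightarrow>
        density \<rho> \<phi> = density lborel (\<lambda>x. ennreal (g x) * \<phi> x)"
    and pos: "\<epsilon>\<^sub>0 > 0" "\<delta> > 0" "n > 0"
    and g: "\<And>x. x \<in> ball z \<delta> \<Longrightarrow> \<epsilon>\<^sub>0 \<le> g x"
    and f: "\<And>x. real n * 2 ^ DIM('a) * \<bar>f x\<bar> \<le> \<epsilon>\<^sub>0" "\<And>x. x \<notin> ball z \<delta> - N \<Longrightarrow> f x = 0"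
    and f0: "(\<integral>x. f x / g x \<partial>\<rho>) = 0"
  shows "compact_prob (density \<rho> (\<lambda>x. ennreal (1 + f x / g x)))"
    and "d_infinity \<rho> (density \<rho> (\<lambda>x. ennreal (1 + f x / g x))) \<le> ereal (2 * \<delta> / real n)"
proof -
  have sets_\<rho>[measurable_cong]: "sets \<rho> = sets borel" and "prob_space \<rho>" and comp: "compact (measure_support \<rho>)"
    using \<rho> by (auto simp: compact_prob_def)
  interpret \<rho>: prob_space \<rho> by fact
  let ?B = "ball z \<delta>"
  have B[measurable]: "?B \<in> sets borel" by simp
  define u where "u x = f x / g x" for x
  have u[measurable]: "u \<in> borel_measurable borel"
    unfolding u_def by measurable
  have f_le: "\<bar>f x\<bar> \<le> \<epsilon>\<^sub>0" for x
  proof -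
    have "1 * \<bar>f x\<bar> \<le> (real n * 2 ^ DIM('a)) * \<bar>f x\<bar>"
      using pos(3) mult_mono[of 1 "real n" 1 "2 ^ DIM('a)"] by (intro mult_right_mono) auto
    with f(1)[of x] show ?thesis by simp
  qed
  have u_le: "\<bar>u x\<bar> \<le> 1" for x
  proof (cases "x \<in> ?B")
    case True
    then show ?thesis
      using g[of x] f_le[of x] pos(1) by (simp add: u_def abs_divide divide_le_eq)
  next
    case False
    then show ?thesis using f(2) by (simp add: u_def)
  qed
  have gu: "g x * u x = f x" for x
    using f(2)[of x] g[of x] pos(1) by (cases "x \<in> ?B") (auto simp: u_def)
  have g_nonneg: "0 \<le> g x" if "u x \<noteq> 0" for x
    using that f(2)[of x] g[of x] pos(1) by (cases "x \<in> ?B") (auto simp: u_def)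
  have uN: "u x = 0" if "x \<in> N" for x
    using f(2)[of x] that by (auto simp: u_def)
  have one_plus_u: "0 \<le> 1 + u x" for x
    using u_le[of x] by auto
  have int_u: "integrable \<rho> u"
    by (rule \<rho>.integrable_const_bound[where B=1]) (auto simp: u_le)
  define \<nu> where "\<nu> = density \<rho> (\<lambda>x. ennreal (1 + u x))"
  have sets_\<nu>[measurable_cong]: "sets \<nu> = sets borel"
    by (simp add: \<nu>_def sets_\<rho>)
  have "emeasure \<nu> (space \<nu>) = (\<integral>\<^sup>+x. ennreal (1 + u x) \<partial>\<rho>)"
    unfolding \<nu>_def by (subst emeasure_density) (auto intro!: nn_integral_cong)
  also have "\<dots> = ennreal (\<integral>x. 1 + u x \<partial>\<rho>)"
    using int_u by (intro nn_integral_eq_integral AE_I2) (auto simp: one_plus_u)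
  also have "(\<integral>x. 1 + u x \<partial>\<rho>) = 1"
    using int_u f0 by (simp add: u_def[symmetric] \<rho>.prob_space)
  finally have "emeasure \<nu> (space \<nu>) = 1" by simp
  then interpret \<nu>: prob_space \<nu>
    by (rule prob_spaceI)
  have null: "emeasure \<nu> U = 0" if "emeasure \<rho> U = 0" "open U" for U
  proof -
    have U: "U \<in> sets \<rho>" using that(2) by (simp add: sets_\<rho>)
    with that(1) have "AE x in \<rho>. x \<notin> U" by (intro AE_not_in null_setsI)
    then have "U \<in> null_sets \<nu>"
      unfolding \<nu>_def using U by (subst null_sets_density_iff) (auto elim: AE_mp)
    then show ?thesis by (rule null_setsD1)
  qed
  have "measure_support \<nu> \<subseteq> measure_support \<rho>"
    unfolding measure_support_def using null by (intro Compl_anti_mono Union_mono) blast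
  then have "compact (measure_support \<nu>)"
    using compact_Int_closed[OF comp closed_measure_support[of \<nu>]] by (simp add: inf.absorb2)
  then show "compact_prob (density \<rho> (\<lambda>x. ennreal (1 + f x / g x)))"
    using sets_\<nu> \<nu>.prob_space_axioms by (simp add: compact_prob_def \<nu>_def u_def)
  define a where "a = density \<rho> (\<lambda>x. ennreal (max 0 (u x)))"
  define b where "b = density \<rho> (\<lambda>x. ennreal (max 0 (- u x)))"
  have gmax: "g x * max 0 (s * u x) = max 0 (s * f x)" for x s
  proof (cases "u x = 0")
    case True
    then show ?thesis using gu[of x] by simp
  next
    case False
    have sf: "s * f x = g x * (s * u x)" using gu[of x] by (simp add: mult.left_commute)
    show ?thesis
    proof (cases "0 \<le> s * u x")
      case True
      then have "0 \<le> s * f x" unfolding sf using g_nonneg[OF False] by simp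
      with True show ?thesis by (simp add: max.absorb2 sf)
    next
      case neg: False
      then have "s * f x \<le> 0" unfolding sf using g_nonneg[OF False] by (simp add: mult_nonneg_nonpos)
      with neg show ?thesis by (simp add: max.absorb1)
    qed
  qed
  have a: "a = density lborel (\<lambda>x. ennreal (max 0 (f x)))"
  proof -
    have "ennreal (g x) * ennreal (max 0 (u x)) = ennreal (max 0 (f x))" for x
      using gmax[of x 1] by (subst ennreal_mult''[symmetric]) auto
    then show ?thesis
      unfolding a_def using uN by (subst dens) auto
  qed
  have b: "b = density lborel (\<lambda>x. ennreal (max 0 (- f x)))"
  proof -
    have "ennreal (g x) * ennreal (max 0 (- u x)) = ennreal (max 0 (- f x))" for x
      using gmax[of x "- 1"] by (subst ennreal_mult''[symmetric]) auto
    then show ?thesis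
      unfolding b_def using uN by (subst dens) auto
  qed
  define c where "c = \<epsilon>\<^sub>0 / (real n * 2 ^ DIM('a))"
  have fc: "\<bar>f x\<bar> \<le> c" for x
    using f(1)[of x] pos by (simp add: c_def pos_le_divide_eq mult.commute)
  have le: "emeasure (density lborel (\<lambda>x. ennreal (k x))) A \<le> ennreal c * emeasure lborel (A \<inter> ?B)"
    if [measurable]: "k \<in> borel_measurable borel" "A \<in> sets borel" and k: "\<And>x. k x \<le> \<bar>f x\<bar>"
    for k :: "'a \<Rightarrow> real" and A
  proof -
    have "emeasure (density lborel (\<lambda>x. ennreal (k x))) A = (\<integral>\<^sup>+x. ennreal (k x) * indicator A x \<partial>lborel)"
      by (rule emeasure_density) auto
    also have "\<dots> \<le> (\<integral>\<^sup>+x. ennreal c * indicator (A \<inter> ?B) x \<partial>lborel)"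
    proof (intro nn_integral_mono)
      fix x
      have "k x \<le> 0" if "x \<notin> ?B" using that k[of x] f(2)[of x] by simp
      then show "ennreal (k x) * indicator A x \<le> ennreal c * indicator (A \<inter> ?B) x"
        using order_trans[OF k[of x] fc] by (auto simp: indicator_def ennreal_neg intro: ennreal_leI)
    qed
    also have "\<dots> = ennreal c * emeasure lborel (A \<inter> ?B)"
      by (rule nn_integral_cmult_indicator) auto
    finally show ?thesis .
  qed
  have balance: "emeasure \<nu> A + emeasure b A = emeasure \<rho> A + emeasure a A" if [measurable]: "A \<in> sets borel" for A
  proof -
    have "emeasure \<nu> A + emeasure b A = (\<integral>\<^sup>+x. ennreal (1 + u x) * indicator A x + ennreal (max 0 (- u x)) * indicator A x \<partial>\<rho>)"
      unfolding \<nu>_def b_def by (subst nn_integral_add) (auto simp: emeasure_density)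
    also have "\<dots> = (\<integral>\<^sup>+x. indicator A x + ennreal (max 0 (u x)) * indicator A x \<partial>\<rho>)"
    proof (intro nn_integral_cong)
      fix x
      have "ennreal (1 + u x) + ennreal (max 0 (- u x)) = ennreal ((1 + u x) + max 0 (- u x))"
        by (rule ennreal_plus[symmetric]) (auto simp: one_plus_u)
      also have "(1 + u x) + max 0 (- u x) = 1 + max 0 (u x)"
        by (simp add: max_def)
      also have "ennreal \<dots> = ennreal 1 + ennreal (max 0 (u x))"
        by (rule ennreal_plus) auto
      finally show "ennreal (1 + u x) * indicator A x + ennreal (max 0 (- u x)) * indicator A x =
            indicator A x + ennreal (max 0 (u x)) * indicator A x"
        by (simp add: indicator_def)
    qed
    also have "\<dots> = emeasure \<rho> A + emeasure a A"
      unfolding a_def by (subst nn_integral_add) (auto simp: emeasure_density)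
    finally show ?thesis .
  qed
  have space_eq: "space \<rho> = UNIV" "space \<nu> = UNIV"
    using sets_eq_imp_space_eq[OF sets_\<rho>] sets_eq_imp_space_eq[OF sets_\<nu>] by auto
  have mass: "emeasure a UNIV = emeasure b UNIV"
    using balance[of UNIV] \<rho>.emeasure_space_1 \<nu>.emeasure_space_1
    by (simp add: space_eq ennreal_add_left_cancel)
  have fin: "finite_measure a" "finite_measure b"
  proof -
    have bound: "emeasure (density \<rho> (\<lambda>x. ennreal (k x))) UNIV \<le> 1"
      if [measurable]: "k \<in> borel_measurable borel" and k: "\<And>x. k x \<le> 1" for k :: "'a \<Rightarrow> real"
    proof -
      have "emeasure (density \<rho> (\<lambda>x. ennreal (k x))) UNIV = (\<integral>\<^sup>+x. ennreal (k x) \<partial>\<rho>)"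
        by (subst emeasure_density) auto
      also have "\<dots> \<le> (\<integral>\<^sup>+x. 1 \<partial>\<rho>)"
        using k by (intro nn_integral_mono) (simp add: ennreal_le_1)
      finally show ?thesis by (simp add: \<rho>.emeasure_space_1)
    qed
    show "finite_measure a" "finite_measure b"
      unfolding a_def b_def
      using bound[of "\<lambda>x. max 0 (u x)"] bound[of "\<lambda>x. max 0 (- u x)"] u_le
      by (auto intro!: finite_measureI simp: space_eq abs_le_iff top_unique)
  qed
  have ge: "of_nat n * (ennreal c * (2 ^ DIM('a) * emeasure lborel (A \<inter> ?B))) \<le> emeasure \<rho> A"
    if [measurable]: "A \<in> sets borel" for A
  proof -
    have "of_nat n * (ennreal c * (2 ^ DIM('a) * emeasure lborel (A \<inter> ?B))) =
        (ennreal (real n) * ennreal c * ennreal (2 ^ DIM('a))) * emeasure lborel (A \<inter> ?B)"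
      by (simp add: ennreal_of_nat_eq_real_of_nat mult.assoc ennreal_power[symmetric])
    also have "ennreal (real n) * ennreal c * ennreal (2 ^ DIM('a)) = ennreal (real n * c * 2 ^ DIM('a))"
    proof -
      have "0 \<le> c" using pos by (simp add: c_def)
      then show ?thesis by (simp add: ennreal_mult)
    qed
    also have "real n * c * 2 ^ DIM('a) = \<epsilon>\<^sub>0"
      using pos by (simp add: c_def)
    also have "ennreal \<epsilon>\<^sub>0 * emeasure lborel (A \<inter> ?B) = (\<integral>\<^sup>+x. ennreal \<epsilon>\<^sub>0 * indicator (A \<inter> ?B) x \<partial>lborel)"
      by (rule nn_integral_cmult_indicator[symmetric]) auto
    also have "\<dots> \<le> (\<integral>\<^sup>+x. ennreal (g x) * indicator (A \<inter> ?B - N) x * indicator UNIV x \<partial>lborel)"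
    proof (rule nn_integral_mono_AE)
      have "AE x in lborel. x \<notin> N"
        using N by (intro AE_not_in) (auto simp: null_sets_def)
      then show "AE x in lborel. ennreal \<epsilon>\<^sub>0 * indicator (A \<inter> ?B) x \<le>
          ennreal (g x) * indicator (A \<inter> ?B - N) x * indicator UNIV x"
        by eventually_elim (auto simp: indicator_def intro!: ennreal_leI g)
    qed
    also have "\<dots> = emeasure (density lborel (\<lambda>x. ennreal (g x) * indicator (A \<inter> ?B - N) x)) UNIV"
      by (rule emeasure_density[symmetric]) auto
    also have "\<dots> = emeasure (density \<rho> (indicator (A \<inter> ?B - N))) UNIV"
      by (subst dens) auto
    also have "\<dots> = emeasure \<rho> (A \<inter> ?B - N)"
      by (subst emeasure_density) (auto simp: sets_\<rho>)
    also have "\<dots> \<le> emeasure \<rho> A"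
      by (intro emeasure_mono) (auto simp: sets_\<rho>)
    finally show ?thesis .
  qed
  have "d_infinity \<rho> \<nu> \<le> ereal (2 * \<delta> / real n)"
  proof (rule d_infinity_le_by_chain[where a=a and b=b and B="?B" and c="ennreal c"])
    show "emeasure a A \<le> ennreal c * emeasure lborel (A \<inter> ?B)" if "A \<in> sets borel" for A
      unfolding a using that by (intro le) auto
    show "emeasure b A \<le> ennreal c * emeasure lborel (A \<inter> ?B)" if "A \<in> sets borel" for A
      unfolding b using that by (intro le) auto
    show "norm (x - y) \<le> 2 * \<delta>" if "x \<in> ?B" "y \<in> ?B" for x y
    proof -
      have "dist x y \<le> dist x z + dist z y" by (rule dist_triangle)
      also have "\<dots> \<le> 2 * \<delta>" using that by (simp add: dist_commute)
      finally show ?thesis by (simp add: dist_norm)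
    qed
  qed (use fin mass pos sets_\<rho> sets_\<nu> ge balance \<rho>.finite_measure_axioms in \<open>auto simp: a b\<close>)
  then show "d_infinity \<rho> (density \<rho> (\<lambda>x. ennreal (1 + f x / g x))) \<le> ereal (2 * \<delta> / real n)"
    by (simp add: \<nu>_def u_def)
qed

section \<open>Minimizers of concave interactions\<close>

text \<open>
  A Borel representative \<open>h\<close> of the density that keeps the lower bound at every point of the ball,
  obtained by raising an arbitrary Borel version to \<open>\<epsilon>\<^sub>0\<close> there, which changes it
  only on a null set.
\<close>
lemma ac_density_on_ball:
  fixes \<rho> :: "'a::euclidean_space measure"
  assumes \<rho>: "sets \<rho> = sets borel"
    and g: "is_ac_density \<rho> g" and ball: "ball z \<delta> \<subseteq> {x. g x \<ge> \<epsilon>\<^sub>0}"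
  obtains h N where "h \<in> borel_measurable borel" "N \<in> sets borel" "emeasure lborel N = 0"
    "\<And>x. x \<in> ball z \<delta> \<Longrightarrow> \<epsilon>\<^sub>0 \<le> h x"
    "\<And>\<phi>. \<phi> \<in> borel_measurable borel \<Longrightarrow> (\<And>x. x \<in> N \<Longrightarrow> \<phi> x = 0) \<Longrightarrow>
        density \<rho> \<phi> = density lborel (\<lambda>x. ennreal (h x) * \<phi> x)"
proof -
  obtain \<sigma> N where int: "integrable lebesgue g"
    and \<sigma>: "sets \<sigma> = sets borel" "N \<in> sets borel" "emeasure lborel N = 0" "emeasure \<sigma> (- N) = 0"
    and decomp: "\<And>A. A \<in> sets borel \<Longrightarrow>
       emeasure \<rho> A = (\<integral>\<^sup>+x. ennreal (g x) * indicator A x \<partial>lebesgue) + emeasure \<sigma> A"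
    using g unfolding is_ac_density_def by blast
  obtain g1 where g1[measurable]: "g1 \<in> borel_measurable borel" and eq: "AE x in lborel. g x = g1 x"
    using completion_ex_borel_measurable_real[OF borel_measurable_integrable[OF int]] by auto
  have [measurable]: "ball z \<delta> \<in> sets borel" by simp
  define h where "h x = (if x \<in> ball z \<delta> then max \<epsilon>\<^sub>0 (g1 x) else g1 x)" for x
  have h[measurable]: "h \<in> borel_measurable borel"
    unfolding h_def by measurable
  have gh: "AE x in lborel. g x = h x"
    using eq by eventually_elim (use ball in \<open>auto simp: h_def max_def\<close>)
  have decomp': "emeasure \<rho> A = (\<integral>\<^sup>+x. ennreal (h x) * indicator A x \<partial>lborel) + emeasure \<sigma> A"
    if "A \<in> sets borel" for A
  proof -
    have "(\<integral>\<^sup>+x. ennreal (g x) * indicator A x \<partial>lebesgue) = (\<integral>\<^sup>+x. ennreal (g x) * indicator A x \<partial>lborel)"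
      by (rule nn_integral_completion)
    also have "\<dots> = (\<integral>\<^sup>+x. ennreal (h x) * indicator A x \<partial>lborel)"
      using gh by (intro nn_integral_cong_AE) auto
    finally show ?thesis using decomp[OF that] by simp
  qed
  show thesis
  proof
    show "\<epsilon>\<^sub>0 \<le> h x" if "x \<in> ball z \<delta>" for x
      using that by (simp add: h_def)
    show "density \<rho> \<phi> = density lborel (\<lambda>x. ennreal (h x) * \<phi> x)"
      if "\<phi> \<in> borel_measurable borel" "\<And>x. x \<in> N \<Longrightarrow> \<phi> x = 0" for \<phi>
      using \<rho> \<sigma> that decomp'
      by (intro density_eq_density_lborel_off_singular[where \<sigma>=\<sigma> and N=N]) auto
  qed (use \<sigma> in auto)
qed

text \<open>
  If the ball were contained in the set, both \<open>\<rho> + t f\<close> and \<open>\<rho> - t f\<close> would be competitors within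
  the radius of minimality, and one of them would have smaller energy than \<open>\<rho>\<close>.
\<close>
lemma concave_imp_no_ball:
  fixes W :: "'a::euclidean_space \<Rightarrow> ereal"
  assumes loc: "locally_integrable W" and c: "\<And>x. ereal c \<le> W x"
    and lsc: "lower_semicontinuous W"
    and \<delta>: "\<delta> > 0" and conc: "linear_interpolation_concave W \<delta>"
    and min: "d_infinity_local_minimizer W \<rho>" and g: "is_ac_density \<rho> g"
    and \<epsilon>\<^sub>0: "\<epsilon>\<^sub>0 > 0"
  shows "\<not> ball z \<delta> \<subseteq> {x. g x \<ge> \<epsilon>\<^sub>0}"
proof
  assume ball: "ball z \<delta> \<subseteq> {x. g x \<ge> \<epsilon>\<^sub>0}"
  have W[measurable]: "W \<in> borel_measurable borel"
    using lsc by (rule lower_semicontinuous_imp_borel)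
  obtain \<epsilon> where cp: "compact_prob \<rho>" and \<epsilon>: "\<epsilon> > 0" and
    le: "\<And>\<nu>. compact_prob \<nu> \<Longrightarrow> d_infinity \<rho> \<nu> < ereal \<epsilon> \<Longrightarrow> energy W \<rho> \<le> energy W \<nu>"
    using min by (auto simp: d_infinity_local_minimizer_def)
  have \<rho>[measurable_cong]: "sets \<rho> = sets borel" and "prob_space \<rho>"
    using cp by (auto simp: compact_prob_def)
  interpret \<rho>: prob_space \<rho> by fact
  have fin: "(\<integral>\<^sup>+z. e2ennreal \<bar>W (fst z - snd z)\<bar> \<partial>(\<rho> \<Otimes>\<^sub>M \<rho>)) < \<infinity>"
    using W loc c min by (rule local_minimizer_finite_interaction)
  obtain h N where h[measurable]: "h \<in> borel_measurable borel" "N \<in> sets borel"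
    and N: "emeasure lborel N = 0" and h_ge: "\<And>x. x \<in> ball z \<delta> \<Longrightarrow> \<epsilon>\<^sub>0 \<le> h x"
    and dens: "\<And>\<phi>. \<phi> \<in> borel_measurable borel \<Longrightarrow> (\<And>x. x \<in> N \<Longrightarrow> \<phi> x = 0) \<Longrightarrow>
        density \<rho> \<phi> = density lborel (\<lambda>x. ennreal (h x) * \<phi> x)"
    using ac_density_on_ball[OF \<rho> g ball] by blast
  obtain f C where f[measurable]: "f \<in> borel_measurable borel" and C: "C > 0" "\<And>x. \<bar>f x\<bar> \<le> C"
    and f_off: "\<And>x. x \<notin> ball z \<delta> - N \<Longrightarrow> f x = 0" and f0: "(\<integral>x. f x \<partial>lborel) = 0"
    and f_neg: "energy_fun W f < 0"
    using concave_profile_on_ball[OF W conc h(2) N, of z] by blast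
  \<comment> \<open>\<open>u \<rho>\<close> is the signed measure \<open>f dx\<close>, since \<open>f\<close> vanishes on \<open>N\<close>.\<close>
  define u where "u x = f x / h x" for x
  have u[measurable]: "u \<in> borel_measurable borel"
    unfolding u_def by measurable
  have on_ball: "x \<in> ball z \<delta> \<Longrightarrow> 0 < h x" for x
    using h_ge[of x] \<epsilon>\<^sub>0 by linarith
  have u_off: "u x = 0" if "x \<notin> ball z \<delta> - N" for x
    using f_off[OF that] by (simp add: u_def)
  have sgn: "sgn (u x) = sgn (f x)" for x
    using on_ball[of x] u_off[of x] f_off[of x]
    by (cases "x \<in> ball z \<delta>") (auto simp: u_def sgn_divide)
  have u_le: "\<bar>u x\<bar> \<le> C / \<epsilon>\<^sub>0" for x
  proof (cases "x \<in> ball z \<delta>")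
    case True
    then have "\<bar>f x\<bar> / h x \<le> C / \<epsilon>\<^sub>0"
      using C \<epsilon>\<^sub>0 h_ge by (intro frac_le) auto
    then show ?thesis using on_ball[OF True] by (simp add: u_def)
  next
    case False
    then show ?thesis using u_off[of x] C \<epsilon>\<^sub>0 by simp
  qed
  have eq: "density \<rho> (\<lambda>x. ennreal \<bar>u x\<bar>) = density lborel (\<lambda>x. ennreal \<bar>f x\<bar>)"
  proof -
    have "ennreal (h x) * ennreal \<bar>u x\<bar> = ennreal \<bar>f x\<bar>" for x
      using on_ball[of x] f_off[of x] u_off[of x]
      by (cases "x \<in> ball z \<delta>") (auto simp: u_def ennreal_mult''[symmetric])
    then show ?thesis
      using u_off by (subst dens) auto
  qed
  have fin_u: "finite_measure (density \<rho> (\<lambda>x. ennreal \<bar>u x\<bar>))"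
  proof -
    have "emeasure (density \<rho> (\<lambda>x. ennreal \<bar>u x\<bar>)) (space \<rho>) = (\<integral>\<^sup>+x. ennreal \<bar>u x\<bar> \<partial>\<rho>)"
      by (subst emeasure_density) (auto intro!: nn_integral_cong)
    also have "\<dots> \<le> (\<integral>\<^sup>+x. ennreal (C / \<epsilon>\<^sub>0) \<partial>\<rho>)"
      by (intro nn_integral_mono ennreal_leI u_le)
    also have "\<dots> < \<infinity>" by (simp add: \<rho>.emeasure_space_1)
    finally show ?thesis by (intro finite_measureI) simp
  qed
  have u0: "(\<integral>x. u x \<partial>\<rho>) = 0"
  proof -
    have abs_sgn: "u x = \<bar>u x\<bar> *\<^sub>R sgn (f x)" "f x = \<bar>f x\<bar> *\<^sub>R sgn (f x)" for x
      using abs_mult_sgn[of "u x"] abs_mult_sgn[of "f x"] sgn[of x] by simp_all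
    have "(\<integral>x. u x \<partial>\<rho>) = (\<integral>x. \<bar>u x\<bar> *\<^sub>R sgn (f x) \<partial>\<rho>)"
      using abs_sgn(1) by (intro Bochner_Integration.integral_cong) auto
    also have "\<dots> = (\<integral>x. sgn (f x) \<partial>density \<rho> (\<lambda>x. ennreal \<bar>u x\<bar>))"
      by (rule integral_density[symmetric]) auto
    also have "\<dots> = (\<integral>x. \<bar>f x\<bar> *\<^sub>R sgn (f x) \<partial>lborel)"
      unfolding eq by (rule integral_density) auto
    also have "\<dots> = (\<integral>x. f x \<partial>lborel)"
      using abs_sgn(2) by (intro Bochner_Integration.integral_cong) auto
    finally show ?thesis using f0 by simp
  qed
  note transfer = double_integral_transfer[OF \<rho> \<rho>.sigma_finite_measure_axioms u f eq fin_u sgn]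
  have "(\<integral>\<^sup>+z. ennreal (\<bar>u (fst z)\<bar> * \<bar>u (snd z)\<bar>) * e2ennreal \<bar>W (fst z - snd z)\<bar> \<partial>(\<rho> \<Otimes>\<^sub>M \<rho>)) \<le>
      (\<integral>\<^sup>+z. ennreal (C / \<epsilon>\<^sub>0 * (C / \<epsilon>\<^sub>0)) * e2ennreal \<bar>W (fst z - snd z)\<bar> \<partial>(\<rho> \<Otimes>\<^sub>M \<rho>))"
    using C \<epsilon>\<^sub>0 by (intro nn_integral_mono mult_right_mono ennreal_leI mult_mono u_le) auto
  also have "\<dots> = ennreal (C / \<epsilon>\<^sub>0 * (C / \<epsilon>\<^sub>0)) * (\<integral>\<^sup>+z. e2ennreal \<bar>W (fst z - snd z)\<bar> \<partial>(\<rho> \<Otimes>\<^sub>M \<rho>))"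
    by (rule nn_integral_cmult) auto
  also have "\<dots> < \<infinity>"
    using fin by (simp add: ennreal_mult_less_top)
  finally have fin_abs: "(\<integral>\<^sup>+z. ennreal (\<bar>f (fst z)\<bar> * \<bar>f (snd z)\<bar>) * e2ennreal \<bar>W (fst z - snd z)\<bar> \<partial>(lborel \<Otimes>\<^sub>M lborel)) < \<infinity>"
    by (subst transfer(1)[symmetric]) auto
  have abs_prod: "ennreal (\<bar>f x\<bar> * \<bar>f y\<bar>) * e2ennreal \<bar>w\<bar> = e2ennreal \<bar>w * ereal (f y) * ereal (f x)\<bar>" for x y w
    by (cases w) (auto simp: ennreal_mult[symmetric] abs_mult ennreal_mult_top ennreal_top_mult
        e2ennreal_neg mult_le_0_iff mult_ac)
  have fin_f: "(\<integral>\<^sup>+z. e2ennreal \<bar>W (fst z - snd z) * ereal (f (snd z)) * ereal (f (fst z))\<bar>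
                 \<partial>(lborel \<Otimes>\<^sub>M lborel)) < \<infinity>"
    using fin_abs unfolding abs_prod .
  have "(\<integral>z. u (fst z) * u (snd z) * real_of_ereal (W (fst z - snd z)) \<partial>(\<rho> \<Otimes>\<^sub>M \<rho>)) =
      (\<integral>z. f (fst z) * f (snd z) * real_of_ereal (W (fst z - snd z)) \<partial>(lborel \<Otimes>\<^sub>M lborel))"
    by (rule transfer(2)) measurable
  also have "\<dots> = (\<integral>z. real_of_ereal (W (fst z - snd z)) * f (fst z) * f (snd z) \<partial>(lborel \<Otimes>\<^sub>M lborel))"
    by (simp add: ac_simps)
  also have "\<dots> < 0"
    using f_neg energy_fun_eq_integral[OF W f fin_f] by simp
  finally have neg: "(\<integral>z. u (fst z) * u (snd z) * real_of_ereal (W (fst z - snd z)) \<partial>(\<rho> \<Otimes>\<^sub>M \<rho>)) < 0" .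
  \<comment> \<open>The number of steps in the chain: each has length at most \<open>2 \<delta> / n < \<epsilon>\<close>.\<close>
  obtain n :: nat where n: "2 * \<delta> / \<epsilon> < real n"
    using reals_Archimedean2 by blast
  have "0 < 2 * \<delta> / \<epsilon>" using \<delta> \<epsilon> by simp
  with n have "n > 0" by (cases n) auto
  have n_small: "2 * \<delta> / real n < \<epsilon>"
    using n \<open>n > 0\<close> \<epsilon> by (simp add: field_simps)
  define D where "D = real n * 2 ^ DIM('a)"
  have "1 \<le> D"
    using \<open>n > 0\<close> mult_mono[of 1 "real n" 1 "2 ^ DIM('a)"] by (simp add: D_def)
  \<comment> \<open>The largest \<open>t\<close> for which \<open>\<bar>f\<bar> \<le> C\<close> guarantees \<open>D * \<bar>t f\<bar> \<le> \<epsilon>\<^sub>0\<close>.\<close>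
  define t where "t = \<epsilon>\<^sub>0 / (D * C)"
  have t: "t > 0" using \<open>1 \<le> D\<close> C \<epsilon>\<^sub>0 by (simp add: t_def)
  have tf: "D * \<bar>t * f x\<bar> \<le> \<epsilon>\<^sub>0" for x
  proof -
    have "D * \<bar>t * f x\<bar> = \<epsilon>\<^sub>0 / C * \<bar>f x\<bar>"
      using \<open>1 \<le> D\<close> C \<epsilon>\<^sub>0 by (simp add: t_def abs_mult)
    also have "\<dots> \<le> \<epsilon>\<^sub>0 / C * C"
      using C \<epsilon>\<^sub>0 by (intro mult_left_mono) auto
    finally show ?thesis using C by simp
  qed
  have not_less: "\<not> energy W (density \<rho> (\<lambda>x. ennreal (1 + s * t * u x))) < energy W \<rho>"
    if s: "\<bar>s\<bar> = 1" for s :: real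
  proof -
    let ?f = "\<lambda>x. s * t * f x"
    have quot: "?f x / h x = s * t * u x" for x by (simp add: u_def)
    have int0: "(\<integral>x. ?f x / h x \<partial>\<rho>) = 0"
      unfolding quot using u0 by simp
    have small: "real n * 2 ^ DIM('a) * \<bar>?f x\<bar> \<le> \<epsilon>\<^sub>0" for x
      using tf[of x] s by (simp add: D_def abs_mult)
    have off: "?f x = 0" if "x \<notin> ball z \<delta> - N" for x
      using f_off[OF that] by simp
    have f'[measurable]: "?f \<in> borel_measurable borel" by measurable
    note adm = perturbation_admissible[where z=z, OF cp f' h N dens \<epsilon>\<^sub>0 \<delta> \<open>n > 0\<close> h_ge small off int0, unfolded quot]
    have "d_infinity \<rho> (density \<rho> (\<lambda>x. ennreal (1 + s * t * u x))) < ereal \<epsilon>"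
      using n_small by (intro order_le_less_trans[OF adm(2)] less_ereal.simps(1)[THEN iffD2])
    then show ?thesis
      using le[OF adm(1)] by (simp add: not_less)
  qed
  have tu: "\<bar>t * u x\<bar> \<le> 1" for x
  proof -
    have "\<bar>t * u x\<bar> \<le> t * (C / \<epsilon>\<^sub>0)"
      unfolding abs_mult using t u_le[of x] by (intro mult_mono) auto
    also have "\<dots> = 1 / D" using C \<epsilon>\<^sub>0 by (simp add: t_def)
    also have "\<dots> \<le> 1" using \<open>1 \<le> D\<close> by simp
    finally show ?thesis .
  qed
  have "energy W (density \<rho> (\<lambda>x. ennreal (1 + t * u x))) < energy W \<rho> \<or>
        energy W (density \<rho> (\<lambda>x. ennreal (1 - t * u x))) < energy W \<rho>"
    using t by (intro energy_decreases_along_perturbation[OF \<rho> \<open>prob_space \<rho>\<close> W u fin _ tu neg]) simp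
  then show False
    using not_less[of 1] not_less[of "- 1"] by simp
qed

theorem theorem7p1:
  fixes W :: "real ^ 'd \<Rightarrow> ereal"
  assumes "\<And>x. W x \<noteq> -\<infinity>"
    and "locally_integrable W"
    and "\<exists>c::real. \<forall>x. ereal c \<le> W x"
    and "lower_semicontinuous W"
    and "\<And>x. W (- x) = W x"
  shows "(\<forall>\<delta>>0. linear_interpolation_concave W \<delta> \<longrightarrow>
            (\<forall>\<rho> g \<epsilon>\<^sub>0. d_infinity_local_minimizer W \<rho> \<and> is_ac_density \<rho> g \<and> \<epsilon>\<^sub>0 > 0 \<longrightarrow>
               \<not> (\<exists>z. ball z \<delta> \<subseteq> {x. g x \<ge> \<epsilon>\<^sub>0}))) \<and>
         (infinitesimal_concave W \<longrightarrow>
            (\<forall>\<rho> g \<epsilon>\<^sub>0. d_infinity_local_minimizer W \<rho> \<and> is_ac_density \<rho> g \<and> \<epsilon>\<^sub>0 > 0 \<longrightarrow>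
               interior {x. g x \<ge> \<epsilon>\<^sub>0} = {}))"
proof -
  obtain c where c: "\<And>x. ereal c \<le> W x"
    using assms(3) by blast
  note no_ball = concave_imp_no_ball[OF assms(2) c assms(4)]
  have "interior {x. g x \<ge> \<epsilon>\<^sub>0} = {}"
    if "infinitesimal_concave W" "d_infinity_local_minimizer W \<rho>" "is_ac_density \<rho> g" "\<epsilon>\<^sub>0 > 0"
    for \<rho> g and \<epsilon>\<^sub>0 :: real
  proof (rule ccontr)
    assume "interior {x. g x \<ge> \<epsilon>\<^sub>0} \<noteq> {}"
    then obtain z where "z \<in> interior {x. g x \<ge> \<epsilon>\<^sub>0}" by blast
    then obtain \<delta> where "\<delta> > 0" "ball z \<delta> \<subseteq> {x. g x \<ge> \<epsilon>\<^sub>0}"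
      unfolding mem_interior by blast
    with that no_ball[of \<delta> \<rho> g \<epsilon>\<^sub>0 z] show False
      by (auto simp: infinitesimal_concave_def)
  qed
  with no_ball show ?thesis by blast
qed

end
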